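(* Let $M\in\mathbb R^{m\times m}$ be symmetric positive definite or skew-Hermitian, let $f:\mathbb R^m\to\mathbb R^m$ be sufficiently smooth, and consider the initial value problem $y'(t)+My(t)=f(y(t))$, $t\in[t_0,t_{\rm end}]$, $y(t_0)=y_0$. Let $\bar a_{21},\bar a_{31},\bar a_{32},\bar a_{41},\bar a_{42},\bar a_{43},\bar b_1,\bar b_2,\bar b_3,\bar b_4$ be real constants and put $\bar c_i=\sum_{j=1}^{i-1}\bar a_{ij}$ for $i=1,2,3,4$ (so $\bar c_1=0$). Consider the four-stage explicit SVERK method (one step of size $h$ starting from $y_0$) \begin{align*} Y_1&=y_0,\\ Y_2&=e^{-\bar c_2hM}y_0+h\bar a_{21}f(Y_1),\\ Y_3&=e^{-\bar c_3hM}y_0+h\big(\bar a_{31}f(Y_1)+\bar a_{32}f(Y_2)\big),\\ Y_4&=e^{-\bar c_4hM}y_0+h\big(\bar a_{41}f(Y_1)+\bar a_{42}f(Y_2)+\bar a_{43}f(Y_3)\big),\\ y_1&=e^{-hM}y_0+h\big(\bar b_1f(Y_1)+\bar b_2f(Y_2)+\bar b_3f(Y_3)+\bar b_4f(Y_4)\big)+\bar w_4(z), \end{align*} where, with $g(y_0)=-My_0+f(y_0)$, \begin{align*} \bar w_4(z)=&-\frac{h^2}{2!}Mf(y_0)+\frac{h^3}{3!}\Big((M-f'_y(y_0))Mf(y_0)-Mf'_y(y_0)g(y_0)\Big)\\ &+\frac{h^4}{4!}\Big((-M+f'_y(y_0))M^2f(y_0)+M^2f'_y(y_0)g(y_0)-Mf''_{yy}(y_0)\big(g(y_0),g(y_0)\big)\\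 &\quad-Mf'_y(y_0)(-M+f'_y(y_0))g(y_0)-f'_y(y_0)Mf'_y(y_0)g(y_0)\\ &\quad-f'_y(y_0)f'_y(y_0)Mf(y_0)+3f''_{yy}(y_0)\big(-Mf(y_0),g(y_0)\big)\Big). \end{align*} If the coefficients satisfy \begin{align*} &\bar b_1+\bar b_2+\bar b_3+\bar b_4=1, && \bar b_2\bar c_2+\bar b_3\bar c_3+\bar b_4\bar c_4=\tfrac12,\\ &\bar b_2\bar c_2^2+\bar b_3\bar c_3^2+\bar b_4\bar c_4^2=\tfrac13, && \bar b_3\bar a_{32}\bar c_2+\bar b_4\bar a_{42}\bar c_2+\bar b_4\bar a_{43}\bar c_3=\tfrac16,\\ &\bar b_2\bar c_2^3+\bar b_3\bar c_3^3+\bar b_4\bar c_4^3=\tfrac14, && \bar b_3\bar c_3\bar a_{32}\bar c_2+\bar b_4\bar c_4\bar a_{42}\bar c_2+\bar b_4\bar c_4\bar a_{43}\bar c_3=\tfrac18,\\ &\bar b_3\bar a_{32}\bar c_2^2+\bar b_4\bar a_{42}\bar c_2^2+\bar b_4\bar a_{43}\bar c_3^2=\tfrac1{12}, && \bar b_4\bar a_{43}\bar a_{32}\bar c_2=\tfrac1{24}, \end{align*} then the method has order four.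
   Context: A one-step method is of order $p$ if, under the assumption $y(t_0)=y_0$, the Taylor expansions in $h$ (at $h=0$) of the numerical solution $y_1$ and of the exact solution $y(t_0+h)$ coincide up to and including the $h^p$ term; for $p=4$ this means $y_1-y(t_0+h)=\mathcal O(h^5)$ as $h\to0$. $f'_y(y)$ denotes the Jacobian matrix of $f$ at $y$, and $f''_{yy}(y)(u,v)$ the second derivative of $f$ at $y$ as a symmetric bilinear map applied to $(u,v)$. The symbol $z$ in $\bar w_4(z)$ is only notation indicating dependence on $hM$; $\bar w_4(z)$ is the vector given by the displayed formula. SVERK stands for "simplified version of exponential Runge--Kutta". *)

theory Defs
  imports "HOL-Analysis.Analysis" "HOL-Library.Landau_Symbols"
begin

definition symmetric_positive_definite :: "real^'m^'m \<Rightarrow> bool" where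
  "symmetric_positive_definite A \<longleftrightarrow> transpose A = A \<and> (\<forall>x. x \<noteq> 0 \<longrightarrow> x \<bullet> (A *v x) > 0)"

definition skew_hermitian :: "complex^'m^'m \<Rightarrow> bool" where
  "skew_hermitian A \<longleftrightarrow> map_matrix cnj (transpose A) = - A"

(* The library multiplication (times) on real^'m^'m is entrywise, so neither (^) nor exp
   gives the matrix operations. *)
primrec matrix_power :: "real^'m^'m \<Rightarrow> nat \<Rightarrow> real^'m^'m" where
  "matrix_power A 0 = mat 1"
| "matrix_power A (Suc k) = A ** matrix_power A k"

definition matrix_exp :: "real^'m^'m \<Rightarrow> real^'m^'m" where
  "matrix_exp A = (\<Sum>k. (1 / fact k) *\<^sub>R matrix_power A k)"

(* Membership in C^k on the whole space. In finite dimension a map is C^(k+1) iff it is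
   differentiable and all its directional derivatives are C^k. *)
primrec is_Ck :: "nat \<Rightarrow> (real^'m \<Rightarrow> real^'m) \<Rightarrow> bool" where
  "is_Ck 0 f \<longleftrightarrow> continuous_on UNIV f"
| "is_Ck (Suc k) f \<longleftrightarrow>
     (\<forall>x. f differentiable (at x)) \<and> (\<forall>v. is_Ck k (\<lambda>x. frechet_derivative f (at x) v))"

definition second_derivative ::
  "(real^'m \<Rightarrow> real^'m) \<Rightarrow> real^'m \<Rightarrow> real^'m \<Rightarrow> real^'m \<Rightarrow> real^'m" where
  "second_derivative f y u v = frechet_derivative (\<lambda>x. frechet_derivative f (at x) v) (at y) u"

(* The initial value problem y' + M y = f(y) on [t0, tend], y(t0) = y0, with one-sided
   derivatives at the endpoints. *)
definition solves_ivp ::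
  "real^'m^'m \<Rightarrow> (real^'m \<Rightarrow> real^'m) \<Rightarrow> real \<Rightarrow> real \<Rightarrow> real^'m \<Rightarrow> (real \<Rightarrow> real^'m) \<Rightarrow> bool" where
  "solves_ivp M f t0 tend y0 y \<longleftrightarrow>
     y t0 = y0 \<and>
     (\<forall>t\<in>{t0..tend}. \<exists>y'. (y has_vector_derivative y') (at t within {t0..tend}) \<and>
        y' + M *v y t = f (y t))"

(* \<Phi> h is the result of one step of size h started from y0. As the exact solution lives on
   [t0, tend] only, h tends to 0 from the right. *)
definition has_order ::
  "nat \<Rightarrow> (real \<Rightarrow> real^'m) \<Rightarrow> real^'m^'m \<Rightarrow> (real^'m \<Rightarrow> real^'m) \<Rightarrow> real \<Rightarrow> real \<Rightarrow> real^'m \<Rightarrow> bool" where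
  "has_order p \<Phi> M f t0 tend y0 \<longleftrightarrow>
     (\<forall>y. solves_ivp M f t0 tend y0 y \<longrightarrow>
        (\<lambda>h. norm (\<Phi> h - y (t0 + h))) \<in> O[at_right 0](\<lambda>h. h ^ (p + 1)))"

definition node :: "(nat \<Rightarrow> nat \<Rightarrow> real) \<Rightarrow> nat \<Rightarrow> real" where
  "node a i = (\<Sum>j = 1..<i. a i j)"

definition w4 :: "real^'m^'m \<Rightarrow> (real^'m \<Rightarrow> real^'m) \<Rightarrow> real^'m \<Rightarrow> real \<Rightarrow> real^'m" where
  "w4 M f y0 h =
    (let F = f y0;
         g = - (M *v y0) + f y0;
         J = jacobian f (at y0);
         H = second_derivative f y0
     in - ((h^2 / fact 2) *\<^sub>R (M *v F))
        + (h^3 / fact 3) *\<^sub>R ((M - J) *v (M *v F) - M *v (J *v g))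
        + (h^4 / fact 4) *\<^sub>R
            ((- M + J) *v (M *v (M *v F))
             + M *v (M *v (J *v g))
             - M *v H g g
             - M *v (J *v ((- M + J) *v g))
             - J *v (M *v (J *v g))
             - J *v (J *v (M *v F))
             + 3 *\<^sub>R H (- (M *v F)) g))"

(* Only the entries a i j with 1 \<le> j < i \<le> 4 and b i with 1 \<le> i \<le> 4 are used. *)
definition sverk4 ::
  "(nat \<Rightarrow> nat \<Rightarrow> real) \<Rightarrow> (nat \<Rightarrow> real) \<Rightarrow> real^'m^'m \<Rightarrow> (real^'m \<Rightarrow> real^'m) \<Rightarrow> real^'m \<Rightarrow> real
    \<Rightarrow> real^'m" where
  "sverk4 a b M f y0 h =
    (let E = (\<lambda>c. matrix_exp ((- (c * h)) *\<^sub>R M) *v y0);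
         Y1 = y0;
         Y2 = E (node a 2) + h *\<^sub>R (a 2 1 *\<^sub>R f Y1);
         Y3 = E (node a 3) + h *\<^sub>R (a 3 1 *\<^sub>R f Y1 + a 3 2 *\<^sub>R f Y2);
         Y4 = E (node a 4) + h *\<^sub>R (a 4 1 *\<^sub>R f Y1 + a 4 2 *\<^sub>R f Y2 + a 4 3 *\<^sub>R f Y3)
     in E 1 + h *\<^sub>R (b 1 *\<^sub>R f Y1 + b 2 *\<^sub>R f Y2 + b 3 *\<^sub>R f Y3 + b 4 *\<^sub>R f Y4)
        + w4 M f y0 h)"

end

theory Submission
  imports Defs
begin

text \<open>
  Both the exact and the numerical solution are compared with explicit polynomials in the step
  size \<open>h\<close>, modulo \<open>O(h\<^sup>n)\<close>. Expansions are obtained without Taylor's theorem: an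
  expansion of a derivative to order \<open>n\<close> integrates to an expansion of the function to order
  \<open>n + 1\<close>. Applied along a polynomial curve this expands \<open>f\<close> composed with the curve, by
  descending to the directional derivatives of \<open>f\<close>; applied to the differential equation it
  bootstraps the expansion of the exact solution. Every stage and every \<open>f(Y\<^sub>i)\<close> is determined
  to the required order by four scalars, so the order conditions are exactly what is needed to
  reduce the weighted sum of the \<open>f(Y\<^sub>i)\<close> to a fixed polynomial, whose difference from the
  exact expansion is \<open>w4\<close>.
\<close>

subsection \<open>Functions agreeing up to a power of the step size\<close>

text \<open>This is \<open>p - q = O(h^n)\<close> as \<open>h\<close> tends to 0 from the right.
  Written out with its constant it covers vector values, and for each \<open>n\<close> it is an
  equivalence that chains in calculations.\<close>

definition agrees :: "nat \<Rightarrow> (real \<Rightarrow> 'a::real_normed_vector) \<Rightarrow> (real \<Rightarrow> 'a) \<Rightarrow> bool" where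
  "agrees n p q \<longleftrightarrow> (\<exists>C. eventually (\<lambda>h. norm (p h - q h) \<le> C * h ^ n) (at_right 0))"

lemma agreesI:
  assumes "\<delta> > 0" "\<And>h. \<lbrakk>0 < h; h < \<delta>\<rbrakk> \<Longrightarrow> norm (p h - q h) \<le> C * h ^ n"
  shows "agrees n p q"
  unfolding agrees_def eventually_at_right_field using assms by blast

text \<open>Enlarging \<open>C\<close> and shrinking the radius is harmless. A positive
  \<open>C\<close> serves monotonicity of products, and a radius of at most 1 makes higher powers of
  \<open>h\<close> smaller.\<close>

lemma agreesE:
  assumes "agrees n p q"
  obtains C \<delta> where "C > 0" "\<delta> > 0" "\<delta> \<le> 1"
    "\<And>h. \<lbrakk>0 < h; h < \<delta>\<rbrakk> \<Longrightarrow> norm (p h - q h) \<le> C * h ^ n"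
proof -
  from assms obtain C \<delta> where "\<delta> > 0"
    and le: "\<And>h. \<lbrakk>0 < h; h < \<delta>\<rbrakk> \<Longrightarrow> norm (p h - q h) \<le> C * h ^ n"
    unfolding agrees_def eventually_at_right_field by blast
  show thesis
  proof
    show "norm (p h - q h) \<le> max 1 C * h ^ n" if "0 < h" "h < min 1 \<delta>" for h

    proof -
      have "C * h ^ n \<le> max 1 C * h ^ n"
        using that by (intro mult_right_mono) auto
      then show ?thesis
        using le[OF that(1)] that(2) by simp
    qed
  qed (use \<open>\<delta> > 0\<close> in auto)
qed

lemma agrees_refl [simp, intro]: "agrees n p p"
  by (rule agreesI[of 1 _ _ 0]) auto

lemma agrees_eq: "p = q \<Longrightarrow> agrees n p q"
  by simp

lemma agrees_sym: "agrees n p q \<Longrightarrow> agrees n q p"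
  by (simp add: agrees_def norm_minus_commute)

lemma agrees_trans [trans]:
  assumes "agrees n p q" "agrees n q r"
  shows "agrees n p r"
proof -
  obtain C1 \<delta>1 where 1: "C1 > 0" "\<delta>1 > 0" "\<delta>1 \<le> 1"
    "\<And>h. \<lbrakk>0 < h; h < \<delta>1\<rbrakk> \<Longrightarrow> norm (p h - q h) \<le> C1 * h ^ n"
    by (rule agreesE[OF assms(1)]) blast
  obtain C2 \<delta>2 where 2: "C2 > 0" "\<delta>2 > 0" "\<delta>2 \<le> 1"
    "\<And>h. \<lbrakk>0 < h; h < \<delta>2\<rbrakk> \<Longrightarrow> norm (q h - r h) \<le> C2 * h ^ n"
    by (rule agreesE[OF assms(2)]) blast
  show ?thesis
  proof (rule agreesI[of "min \<delta>1 \<delta>2"])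
    fix h :: real assume "0 < h" "h < min \<delta>1 \<delta>2"
    then have "norm (p h - q h) \<le> C1 * h ^ n" "norm (q h - r h) \<le> C2 * h ^ n"
      using 1 2 by auto
    then show "norm (p h - r h) \<le> (C1 + C2) * h ^ n"
      using norm_triangle_ineq[of "p h - q h" "q h - r h"] by (simp add: algebra_simps)
  qed (use 1 2 in auto)
qed

lemma agrees_mono:
  assumes "agrees n p q" "m \<le> n"
  shows "agrees m p q"
proof -
  obtain C \<delta> where *: "C > 0" "\<delta> > 0" "\<delta> \<le> 1"
    "\<And>h. \<lbrakk>0 < h; h < \<delta>\<rbrakk> \<Longrightarrow> norm (p h - q h) \<le> C * h ^ n"
    by (rule agreesE[OF assms(1)]) blast
  show ?thesis
  proof (rule agreesI[OF \<open>\<delta> > 0\<close>])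
    fix h :: real assume h: "0 < h" "h < \<delta>"
    then have "h ^ n \<le> h ^ m"
      using * assms(2) by (intro power_decreasing) auto
    then show "norm (p h - q h) \<le> C * h ^ m"
      using *(4)[OF h] \<open>C > 0\<close> by (smt (verit) mult_left_mono)
  qed
qed

lemma agrees_add:
  assumes "agrees n p q" "agrees n p' q'"
  shows "agrees n (\<lambda>h. p h + p' h) (\<lambda>h. q h + q' h)"
proof -
  have "agrees n (\<lambda>h. p h + p' h) (\<lambda>h. q h + p' h)"
    using assms(1) by (simp add: agrees_def)
  also have "agrees n \<dots> (\<lambda>h. q h + q' h)"
    using assms(2) by (simp add: agrees_def)
  finally show ?thesis .
qed

lemma agrees_sum:
  assumes "\<And>j. j \<in> I \<Longrightarrow> agrees n (p j) (q j)"
  shows "agrees n (\<lambda>h. \<Sum>j\<in>I. p j h) (\<lambda>h. \<Sum>j\<in>I. q j h)"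
  using assms by (induction I rule: infinite_finite_induct) (auto intro: agrees_add)

lemma agrees_bounded_linear:
  assumes "bounded_linear L" "agrees n p q"
  shows "agrees n (\<lambda>h. L (p h)) (\<lambda>h. L (q h))"
proof -
  interpret bounded_linear L by fact
  obtain C \<delta> where *: "C > 0" "\<delta> > 0" "\<delta> \<le> 1"
    "\<And>h. \<lbrakk>0 < h; h < \<delta>\<rbrakk> \<Longrightarrow> norm (p h - q h) \<le> C * h ^ n"
    by (rule agreesE[OF assms(2)]) blast
  obtain K where K: "K \<ge> 0" "\<And>x. norm (L x) \<le> norm x * K"
    using nonneg_bounded by blast
  show ?thesis
  proof (rule agreesI[OF \<open>\<delta> > 0\<close>])
    fix h :: real assume h: "0 < h" "h < \<delta>"
    have "norm (L (p h) - L (q h)) \<le> norm (p h - q h) * K"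
      using K(2)[of "p h - q h"] by (simp add: diff)
    also have "\<dots> \<le> C * h ^ n * K"
      using *(4)[OF h] K(1) by (rule mult_right_mono)
    finally show "norm (L (p h) - L (q h)) \<le> (K * C) * h ^ n"
      by (simp add: mult_ac)
  qed
qed

lemma agrees_scaleR: "agrees n p q \<Longrightarrow> agrees n (\<lambda>h. s *\<^sub>R p h) (\<lambda>h. s *\<^sub>R q h)"
  by (rule agrees_bounded_linear[OF bounded_linear_scaleR_right])

lemma agrees_power_scaleR:
  assumes "agrees n p q"
  shows "agrees (k + n) (\<lambda>h. h ^ k *\<^sub>R p h) (\<lambda>h. h ^ k *\<^sub>R q h)"
proof -
  obtain C \<delta> where *: "C > 0" "\<delta> > 0" "\<delta> \<le> 1"
    "\<And>h. \<lbrakk>0 < h; h < \<delta>\<rbrakk> \<Longrightarrow> norm (p h - q h) \<le> C * h ^ n"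
    by (rule agreesE[OF assms]) blast
  show ?thesis
  proof (rule agreesI[OF \<open>\<delta> > 0\<close>])
    fix h :: real assume h: "0 < h" "h < \<delta>"
    have "norm (h ^ k *\<^sub>R p h - h ^ k *\<^sub>R q h) = h ^ k * norm (p h - q h)"
      using h by (simp flip: scaleR_diff_right)
    also have "\<dots> \<le> h ^ k * (C * h ^ n)"
      using *(4)[OF h] h by (intro mult_left_mono) auto
    finally show "norm (h ^ k *\<^sub>R p h - h ^ k *\<^sub>R q h) \<le> C * h ^ (k + n)"
      by (simp add: power_add mult_ac)
  qed
qed

lemma agrees_times_scaleR:
  "agrees n p q \<Longrightarrow> agrees (Suc n) (\<lambda>h. h *\<^sub>R p h) (\<lambda>h. h *\<^sub>R q h)"
  using agrees_power_scaleR[of n p q 1] by simp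

lemma agrees_drop_term: "n \<le> k \<Longrightarrow> agrees n (\<lambda>h. p h + h ^ k *\<^sub>R v) p"
  by (rule agrees_mono[of k], rule agreesI[of 1 _ _ "norm v"]) auto

text \<open>Order 0 only says that the difference stays bounded near 0. This starts the bootstrap
  for the exact solution.\<close>

lemma agrees_0_of_tendsto:
  assumes "(p \<longlongrightarrow> l) (at_right 0)"
  shows "agrees 0 p (\<lambda>_. l)"
proof -
  have "eventually (\<lambda>h. norm (p h - l) \<le> 1 * h ^ 0) (at_right 0)"
    using tendstoD[OF assms zero_less_one] by eventually_elim (simp add: dist_norm)
  then show ?thesis
    unfolding agrees_def by blast
qed

lemma agrees_imp_tendsto:
  assumes "agrees n p q" "n > 0" "(q \<longlongrightarrow> l) (at_right 0)"
  shows "(p \<longlongrightarrow> l) (at_right 0)"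
proof -
  obtain C where "eventually (\<lambda>h. norm (p h - q h) \<le> C * h ^ n) (at_right 0)"
    using assms(1) unfolding agrees_def by blast
  moreover have "((\<lambda>h. C * h ^ n) \<longlongrightarrow> C * 0 ^ n) (at_right 0)"
    by (intro tendsto_intros)
  then have "((\<lambda>h. C * h ^ n) \<longlongrightarrow> 0) (at_right 0)"
    using \<open>n > 0\<close> by (simp add: zero_power)
  ultimately have "((\<lambda>h. p h - q h) \<longlongrightarrow> 0) (at_right 0)"
    by (rule Lim_null_comparison)
  from tendsto_add[OF this assms(3)] show ?thesis by simp
qed

text \<open>The mean value inequality for \<open>p - q\<close>, which vanishes at 0, bounds it at
  \<open>h\<close> by \<open>h\<close> times its derivative at some \<open>x < h\<close>. Since
  \<open>x ^ n \<le> h ^ n\<close>, one power of \<open>h\<close> is gained.\<close>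

lemma agrees_integrate:
  fixes p q :: "real \<Rightarrow> 'a::real_inner"
  assumes "T > 0"
    and p: "\<And>h. h \<in> {0..T} \<Longrightarrow> (p has_vector_derivative p' h) (at h within {0..T})"
    and q: "\<And>h. h \<in> {0..T} \<Longrightarrow> (q has_vector_derivative q' h) (at h within {0..T})"
    and "p 0 = q 0" "agrees n p' q'"
  shows "agrees (Suc n) p q"
proof -
  obtain C \<delta> where *: "C > 0" "\<delta> > 0" "\<delta> \<le> 1"
    "\<And>h. \<lbrakk>0 < h; h < \<delta>\<rbrakk> \<Longrightarrow> norm (p' h - q' h) \<le> C * h ^ n"
    by (rule agreesE[OF assms(5)]) blast
  show ?thesis
  proof (rule agreesI[of "min \<delta> T"])
    fix h :: real assume h: "0 < h" "h < min \<delta> T"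
    let ?r = "\<lambda>h. p h - q h"
    have r: "(?r has_vector_derivative (p' x - q' x)) (at x within {0..T})" if "x \<in> {0..T}" for x
      using p[OF that] q[OF that] by (rule has_vector_derivative_diff)
    have "continuous_on {0..T} ?r"
      unfolding continuous_on_eq_continuous_within
      by (intro ballI has_vector_derivative_continuous[OF r])
    then have cont: "continuous_on {0..h} ?r"
      by (rule continuous_on_subset) (use h in auto)
    \<comment> \<open>At interior points the derivative within the interval is a two-sided one, as
      \<open>mvt_general\<close> demands.\<close>
    have "(?r has_derivative (\<lambda>s. s *\<^sub>R (p' x - q' x))) (at x)" if "0 < x" "x < h" for x
      using r[of x] that h by (simp add: has_vector_derivative_def at_within_Icc_at)
    from mvt_general[OF h(1) cont this]
    obtain x where x: "x \<in> {0<..<h}" "norm (?r h - ?r 0) \<le> norm ((h - 0) *\<^sub>R (p' x - q' x))"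
      by blast
    have "norm (?r h) \<le> h * norm (p' x - q' x)"
      using x(2) h(1) assms(4) by simp
    also have "\<dots> \<le> h * (C * h ^ n)"
    proof (rule mult_left_mono)
      have "norm (p' x - q' x) \<le> C * x ^ n"
        using x(1) h by (intro *(4)) auto
      also have "\<dots> \<le> C * h ^ n"
        using x \<open>C > 0\<close> by (intro mult_left_mono power_mono) auto
      finally show "norm (p' x - q' x) \<le> C * h ^ n" .
    qed (use h in simp)
    finally show "norm (p h - q h) \<le> C * h ^ Suc n"
      by (simp add: mult_ac)
  qed (use assms * in auto)
qed

subsection \<open>Continuously differentiable maps and symmetry of second derivatives\<close>

text \<open>With the direction placed before the point, \<open>dir_deriv f v\<close> is again a
  vector field, so derivatives can be iterated and \<open>is_Ck\<close> descends to them.\<close>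

definition dir_deriv :: "(real^'m \<Rightarrow> real^'m) \<Rightarrow> real^'m \<Rightarrow> real^'m \<Rightarrow> real^'m" where
  "dir_deriv f v x = frechet_derivative f (at x) v"

lemma is_Ck_dir_deriv: "is_Ck (Suc k) f \<Longrightarrow> is_Ck k (dir_deriv f v)"
  by (simp add: dir_deriv_def[abs_def])

lemma has_derivative_dir_deriv:
  assumes "is_Ck (Suc k) f"
  shows "(f has_derivative (\<lambda>v. dir_deriv f v x)) (at x)"
  using assms by (simp add: dir_deriv_def frechet_derivative_works[symmetric])

lemma linear_dir_deriv: "is_Ck (Suc k) f \<Longrightarrow> linear (\<lambda>v. dir_deriv f v x)"
  using has_derivative_dir_deriv by (blast intro: has_derivative_linear)

text \<open>The induction is over all \<open>f\<close>, because its hypothesis is applied to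
  directional derivatives. At the bottom, differentiability gives continuity.\<close>

lemma is_Ck_pred: "is_Ck (Suc k) f \<Longrightarrow> is_Ck k f"
proof (induction k arbitrary: f)
  case 0
  then show ?case
    by (auto intro!: differentiable_imp_continuous_on differentiable_at_imp_differentiable_on)
next
  case (Suc k)
  have "f differentiable (at x)" for x
    using Suc.prems by simp
  moreover have "is_Ck k (\<lambda>x. frechet_derivative f (at x) v)" for v
    using Suc.prems by (intro Suc.IH) simp
  ultimately show ?case by simp
qed

lemma is_Ck_mono: "\<lbrakk>is_Ck n f; m \<le> n\<rbrakk> \<Longrightarrow> is_Ck m f"
  proof (induction n)
  case (Suc n)
  then show ?case
    using is_Ck_pred[of n f] by (metis le_Suc_eq)
qed simp

text \<open>\<open>is_Ck\<close> makes each directional derivative continuous separately, hence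
  bounded on the compact ball. Expanding a direction in the finite basis combines these bounds into
  one for the operator norm.\<close>

lemma is_C1_lipschitz:
  fixes f :: "real^'m \<Rightarrow> real^'m"
  assumes "is_Ck 1 f"
  obtains L where "\<And>x y. \<lbrakk>x \<in> cball z 1; y \<in> cball z 1\<rbrakk> \<Longrightarrow> norm (f x - f y) \<le> L * norm (x - y)"
proof -
  have f: "is_Ck (Suc 0) f" using assms by simp
  let ?S = "cball z (1::real)"
  have "\<exists>K. \<forall>x\<in>?S. norm (dir_deriv f e x) \<le> K" for e
  proof -
    have "continuous_on UNIV (dir_deriv f e)"
      using is_Ck_dir_deriv[OF f] by simp
    then have "compact (dir_deriv f e ` ?S)"
      by (intro compact_continuous_image) (auto intro: continuous_on_subset)
    then show ?thesis
      using compact_imp_bounded bounded_iff by (metis imageI)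
  qed
  then obtain K where K: "\<And>e x. x \<in> ?S \<Longrightarrow> norm (dir_deriv f e x) \<le> K e" by metis
  have "norm (f x - f y) \<le> (\<Sum>i\<in>Basis. K i) * norm (x - y)" if "x \<in> ?S" "y \<in> ?S" for x y
  proof (rule differentiable_bound[OF convex_cball _ _ that])
    fix w assume w: "w \<in> ?S"
    show "(f has_derivative (\<lambda>v. dir_deriv f v w)) (at w within ?S)"
      using has_derivative_dir_deriv[OF f] by (rule has_derivative_at_withinI)
    show "onorm (\<lambda>v. dir_deriv f v w) \<le> (\<Sum>i\<in>Basis. K i)"
    proof (rule onorm_le)
      fix v :: "real^'m"
      have "dir_deriv f v w = dir_deriv f (\<Sum>i\<in>Basis. (v \<bullet> i) *\<^sub>R i) w"
        by (simp add: euclidean_representation)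
      also have "\<dots> = (\<Sum>i\<in>Basis. (v \<bullet> i) *\<^sub>R dir_deriv f i w)"
        by (simp add: linear_sum[OF linear_dir_deriv[OF f]] linear_cmul[OF linear_dir_deriv[OF f]])
      also have "norm \<dots> \<le> (\<Sum>i\<in>Basis. norm v * K i)"
        using K[OF w]
        by (intro sum_norm_le) (auto intro!: mult_mono Basis_le_norm)
      finally show "norm (dir_deriv f v w) \<le> (\<Sum>i\<in>Basis. K i) * norm v"
        by (simp add: sum_distrib_left mult_ac)
    qed
  qed
  then show thesis by (rule that)
qed

text \<open>The common limit brings both curves into a ball on which \<open>f\<close> is
  Lipschitz.\<close>

lemma agrees_C1_compose:
  fixes f :: "real^'m \<Rightarrow> real^'m"
  assumes "is_Ck 1 f" "agrees n p q"
    and "(p \<longlongrightarrow> l) (at_right 0)" "(q \<longlongrightarrow> l) (at_right 0)"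
  shows "agrees n (\<lambda>h. f (p h)) (\<lambda>h. f (q h))"
proof -
  obtain L where L: "\<And>x y. \<lbrakk>x \<in> cball l 1; y \<in> cball l 1\<rbrakk> \<Longrightarrow> norm (f x - f y) \<le> L * norm (x - y)"
    by (rule is_C1_lipschitz[OF assms(1), where z = l]) blast
  obtain C where "eventually (\<lambda>h. norm (p h - q h) \<le> C * h ^ n) (at_right 0)"
    using assms(2) by (auto simp: agrees_def)
  moreover have "eventually (\<lambda>h. dist (p h) l < 1) (at_right 0)"
    "eventually (\<lambda>h. dist (q h) l < 1) (at_right 0)"
    using assms(3,4) by (auto intro: tendstoD)
  ultimately have "eventually (\<lambda>h. norm (f (p h) - f (q h)) \<le> (\<bar>L\<bar> * C) * h ^ n) (at_right 0)"
  proof eventually_elim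
    case (elim h)
    have "norm (f (p h) - f (q h)) \<le> L * norm (p h - q h)"
      using elim by (intro L) (auto simp: dist_commute)
    \<comment> \<open>\<open>L\<close> is not known to be nonnegative, so its absolute value
      replaces it before the next monotonicity step.\<close>
    also have "\<dots> \<le> \<bar>L\<bar> * norm (p h - q h)"
      by (intro mult_right_mono) auto
    also have "\<dots> \<le> \<bar>L\<bar> * (C * h ^ n)"
      using elim by (intro mult_left_mono) auto
    finally show ?case by (simp add: mult_ac)
  qed
  then show ?thesis by (auto simp: agrees_def)
qed

lemma has_vector_derivative_dir_deriv:
  assumes "is_Ck (Suc k) f" "(p has_vector_derivative p') (at h within S)"
  shows "((\<lambda>h. f (p h)) has_vector_derivative dir_deriv f p' (p h)) (at h within S)"
  using has_derivative_compose[OF assms(2)[unfolded has_vector_derivative_def]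
      has_derivative_dir_deriv[OF assms(1)]]
  by (simp add: has_vector_derivative_def linear_cmul[OF linear_dir_deriv[OF assms(1)]])

section \<open>Symmetry of mixed second derivatives\<close>

text \<open>The mean value inequality along \<open>v\<close> reduces the second difference to values
  of \<open>dir_deriv f v\<close> at two points near \<open>x\<close>. Differentiability of that
  field at \<open>x\<close> linearises both values, and the linear parts differ by \<open>h\<close>
  times the mixed derivative.\<close>

lemma second_difference_bound:
  fixes f :: "real^'m \<Rightarrow> real^'m"
  assumes f: "is_Ck 2 f" and "e > 0"
  obtains d where "d > 0"
    "\<And>h. \<lbrakk>0 < h; h < d\<rbrakk> \<Longrightarrow>
       norm (f (x + h *\<^sub>R u + h *\<^sub>R v) - f (x + h *\<^sub>R u) - f (x + h *\<^sub>R v) + f x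
         - h\<^sup>2 *\<^sub>R dir_deriv (dir_deriv f v) u x) \<le> 2 * e * (norm u + norm v) * h\<^sup>2"
proof -
  define G where "G = dir_deriv f v"
  define G' where "G' = (\<lambda>u. dir_deriv G u x)"
  define K where "K = norm u + norm v"
  have f': "is_Ck (Suc 1) f" using f by (simp add: numeral_2_eq_2)
  have G: "is_Ck (Suc 0) G"
    unfolding G_def using is_Ck_dir_deriv[OF f'] by simp
  have linG': "linear G'"
    unfolding G'_def using linear_dir_deriv[OF G] .
  have "(G has_derivative G') (at x)"
    unfolding G'_def by (rule has_derivative_dir_deriv[OF G])
  then obtain d0 where d0: "d0 > 0"
    "\<And>y. norm (y - x) < d0 \<Longrightarrow> norm (G y - G x - G' (y - x)) \<le> e * norm (y - x)"
    using \<open>e > 0\<close> unfolding has_derivative_at_alt by blast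
  have K: "K \<ge> 0" by (simp add: K_def)
  show thesis
  proof
    \<comment> \<open>This radius forces \<open>h * K < d0\<close>; the \<open>+ 1\<close> keeps it
      positive when both directions vanish.\<close>
    show "d0 / (K + 1) > 0" using d0 K by simp
    fix h :: real assume h: "0 < h" "h < d0 / (K + 1)"
    have hK: "h * K < d0"
      using h K by (simp add: pos_less_divide_eq algebra_simps)
    \<comment> \<open>The last term is chosen so that \<open>?F h - ?F 0\<close> is exactly the
      second difference minus \<open>h\<^sup>2 *\<^sub>R G' u\<close>.\<close>
    let ?F = "\<lambda>s. f (x + h *\<^sub>R u + s *\<^sub>R v) - f (x + s *\<^sub>R v) - s *\<^sub>R (h *\<^sub>R G' u)"
    let ?F' = "\<lambda>s. G (x + h *\<^sub>R u + s *\<^sub>R v) - G (x + s *\<^sub>R v) - h *\<^sub>R G' u"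
    have F: "(?F has_vector_derivative ?F' s) (at s)" for s
    proof -
      have "((\<lambda>s. x + h *\<^sub>R u + s *\<^sub>R v) has_vector_derivative v) (at s)"
        "((\<lambda>s. x + s *\<^sub>R v) has_vector_derivative v) (at s)"
        "((\<lambda>s. s *\<^sub>R (h *\<^sub>R G' u)) has_vector_derivative h *\<^sub>R G' u) (at s)"
        by (auto intro!: derivative_eq_intros)
      then show ?thesis
        unfolding G_def
        by (intro has_vector_derivative_diff has_vector_derivative_dir_deriv[OF f'])
    qed
    have "continuous_on {0..h} ?F"
      unfolding continuous_on_eq_continuous_within
      using has_vector_derivative_continuous[OF has_vector_derivative_at_within[OF F]] by simp
    from mvt_general[OF h(1) this F[unfolded has_vector_derivative_def]]
    obtain s where s: "0 < s" "s < h" "norm (?F h - ?F 0) \<le> h * norm (?F' s)"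
      using h(1) by auto
    have near: "norm (w + s *\<^sub>R v) \<le> h * K" if "norm w \<le> h * norm u" for w
    proof -
      have "norm (w + s *\<^sub>R v) \<le> h * norm u + s * norm v"
        using norm_triangle_ineq[of w "s *\<^sub>R v"] that s by simp
      also have "\<dots> \<le> h * norm u + h * norm v"
        using s by (intro add_mono mult_right_mono) auto
      finally show ?thesis by (simp add: K_def algebra_simps)
    qed
    have bound: "norm (G (x + w + s *\<^sub>R v) - G x - G' (w + s *\<^sub>R v)) \<le> e * (h * K)"
      if "norm w \<le> h * norm u" for w
    proof -
      have "norm (G (x + w + s *\<^sub>R v) - G x - G' (w + s *\<^sub>R v)) \<le> e * norm (w + s *\<^sub>R v)"
        using d0(2)[of "x + w + s *\<^sub>R v"] near[OF that] hK by (simp add: add.assoc)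
      also have "\<dots> \<le> e * (h * K)"
        using near[OF that] \<open>e > 0\<close> by (intro mult_left_mono) auto
      finally show ?thesis .
    qed
    \<comment> \<open>The linear parts inserted here differ by \<open>h *\<^sub>R G' u\<close>. The
      summand \<open>0\<close> lets \<open>bound\<close> apply with \<open>w = 0\<close>.\<close>
    have "?F' s = (G (x + h *\<^sub>R u + s *\<^sub>R v) - G x - G' (h *\<^sub>R u + s *\<^sub>R v))
        - (G (x + 0 + s *\<^sub>R v) - G x - G' (0 + s *\<^sub>R v))"
      by (simp add: linear_add[OF linG'] linear_cmul[OF linG'])
    also have "norm \<dots> \<le> e * (h * K) + e * (h * K)"
      using h by (intro norm_triangle_le_diff[OF add_mono[OF bound bound]]) auto
    finally have F's: "norm (?F' s) \<le> 2 * e * K * h" by (simp add: mult_ac)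
    have "norm (?F h - ?F 0) \<le> h * (2 * e * K * h)"
      using order_trans[OF s(3) mult_left_mono[OF F's, of h]] h(1) by simp
    then show "norm (f (x + h *\<^sub>R u + h *\<^sub>R v) - f (x + h *\<^sub>R u) - f (x + h *\<^sub>R v) + f x
         - h\<^sup>2 *\<^sub>R dir_deriv (dir_deriv f v) u x) \<le> 2 * e * (norm u + norm v) * h\<^sup>2"
      by (simp add: G'_def G_def K_def power2_eq_square algebra_simps)
  qed
qed

text \<open>The second difference is symmetric in \<open>u\<close> and \<open>v\<close>, so after
  division by \<open>h\<^sup>2\<close> it approaches both mixed derivatives.\<close>

lemma dir_deriv_commute:
  fixes f :: "real^'m \<Rightarrow> real^'m"
  assumes "is_Ck 2 f"
  shows "dir_deriv (dir_deriv f u) v x = dir_deriv (dir_deriv f v) u x"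
proof (rule ccontr)
  assume neq: "\<not> ?thesis"
  let ?A = "dir_deriv (dir_deriv f v) u x" and ?B = "dir_deriv (dir_deriv f u) v x"
  define K where "K = norm u + norm v"
  \<comment> \<open>With this choice \<open>4 * e * (K + 1)\<close> is the distance of the two
    derivatives, whereas the two estimates bound that distance by \<open>4 * e * K\<close>.\<close>
  define e where "e = norm (?A - ?B) / (4 * (K + 1))"
  have "K \<ge> 0" by (simp add: K_def)
  have "norm (?A - ?B) > 0" using neq by auto
  then have "e > 0" using \<open>K \<ge> 0\<close> by (simp add: e_def)
  define S where "S h = f (x + h *\<^sub>R u + h *\<^sub>R v) - f (x + h *\<^sub>R u) - f (x + h *\<^sub>R v) + f x" for h
  obtain d1 where d1: "d1 > 0"
    "\<And>h. \<lbrakk>0 < h; h < d1\<rbrakk> \<Longrightarrow> norm (S h - h\<^sup>2 *\<^sub>R ?A) \<le> 2 * e * K * h\<^sup>2"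
    by (rule second_difference_bound[OF assms \<open>e > 0\<close>, of x u v])
      (simp add: S_def K_def)
  obtain d2 where d2: "d2 > 0"
    "\<And>h. \<lbrakk>0 < h; h < d2\<rbrakk> \<Longrightarrow> norm (S h - h\<^sup>2 *\<^sub>R ?B) \<le> 2 * e * K * h\<^sup>2"
    by (rule second_difference_bound[OF assms \<open>e > 0\<close>, of x v u])
      (simp add: S_def K_def algebra_simps)
  obtain h where h: "0 < h" "h < d1" "h < d2"
    using d1(1) d2(1) field_lbound_gt_zero by blast
  have "h\<^sup>2 * norm (?A - ?B) = norm ((S h - h\<^sup>2 *\<^sub>R ?B) - (S h - h\<^sup>2 *\<^sub>R ?A))"
    by (simp flip: scaleR_diff_right)
  also have "\<dots> \<le> 2 * e * K * h\<^sup>2 + 2 * e * K * h\<^sup>2"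
    using add_mono[OF d2(2) d1(2), of h h] h by (intro norm_triangle_le_diff) auto
  also have "\<dots> = h\<^sup>2 * (4 * e * K)" by simp
  finally have "norm (?A - ?B) \<le> 4 * e * K"
    using h(1) by (simp only: mult_le_cancel_left_pos zero_less_power)
  also have "\<dots> < 4 * e * (K + 1)" using \<open>e > 0\<close> by simp
  also have "\<dots> = norm (?A - ?B)" using \<open>K \<ge> 0\<close> unfolding e_def by (simp del: distrib_left_numeral)
  finally show False by simp
qed

section \<open>Expansions of a smooth map along polynomial curves\<close>

lemma quartic_has_vector_derivative:
  fixes x u v w z :: "'a::real_normed_vector"
  shows "((\<lambda>h. x + h *\<^sub>R u + h^2 *\<^sub>R v + h^3 *\<^sub>R w + h^4 *\<^sub>R z) has_vector_derivative
     u + h *\<^sub>R (2 *\<^sub>R v) + h^2 *\<^sub>R (3 *\<^sub>R w) + h^3 *\<^sub>R (4 *\<^sub>R z)) (at h within S)"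
  by (auto intro!: derivative_eq_intros simp: algebra_simps)

text \<open>The Lipschitz estimate replaces \<open>p\<close> by the polynomial curve
  \<open>q\<close>; the chain rule and integration then compare \<open>f\<close> along
  \<open>q\<close> with \<open>r\<close>. An expansion of \<open>f\<close> is thus reduced to one of
  its directional derivatives, one order lower.\<close>

lemma agrees_compose_curve:
  fixes f :: "real^'m \<Rightarrow> real^'m"
  assumes "is_Ck (Suc k) f" "agrees (Suc n) p q"
    and "\<And>h. (q has_vector_derivative q' h) (at h)"
    and "\<And>h. (r has_vector_derivative r' h) (at h)" "r 0 = f (q 0)"
    and "agrees n (\<lambda>h. dir_deriv f (q' h) (q h)) r'"
  shows "agrees (Suc n) (\<lambda>h. f (p h)) r"
proof -
  have q: "(q \<longlongrightarrow> q 0) (at_right 0)"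
    using has_vector_derivative_continuous[OF assms(3)[of 0]]
    by (simp add: continuous_at filterlim_at_split)
  have "agrees (Suc n) (\<lambda>h. f (p h)) (\<lambda>h. f (q h))"
    by (rule agrees_C1_compose[OF is_Ck_mono[OF assms(1)] assms(2) agrees_imp_tendsto[OF assms(2) _ q] q]) auto
  also have "agrees (Suc n) \<dots> r"
    by (rule agrees_integrate[OF zero_less_one _ _ _ assms(6)])
      (auto simp: assms(5) intro: has_vector_derivative_at_within assms(4)
        has_vector_derivative_dir_deriv[OF assms(1)] assms(3))
  finally show ?thesis .
qed

lemma agrees_drop_linear: "agrees 1 (\<lambda>h. x + h *\<^sub>R u) (\<lambda>_. x)"
  using agrees_drop_term[of 1 1 "\<lambda>_. x" u] by simp

lemma compose_expansion_1:
  fixes f :: "real^'m \<Rightarrow> real^'m"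
  assumes "is_Ck 1 f" "agrees 1 p (\<lambda>_. x)"
  shows "agrees 1 (\<lambda>h. f (p h)) (\<lambda>_. f x)"
  by (rule agrees_C1_compose[OF assms agrees_imp_tendsto[OF assms(2)]]) auto

lemma compose_expansion_2:
  fixes f :: "real^'m \<Rightarrow> real^'m"
  assumes "is_Ck 2 f" "agrees 2 p (\<lambda>h. x + h *\<^sub>R u)"
  shows "agrees 2 (\<lambda>h. f (p h)) (\<lambda>h. f x + h *\<^sub>R dir_deriv f u x)"
proof -
  have f: "is_Ck (Suc 1) f" using assms(1) by (simp add: numeral_2_eq_2)
  show ?thesis
    unfolding numeral_2_eq_2
  proof (rule agrees_compose_curve[OF f assms(2)[unfolded numeral_2_eq_2]])
    show "((\<lambda>h. x + h *\<^sub>R u) has_vector_derivative u) (at h)"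
      "((\<lambda>h. f x + h *\<^sub>R dir_deriv f u x) has_vector_derivative dir_deriv f u x) (at h)" for h
      by (auto intro!: derivative_eq_intros)
    have "agrees 1 (\<lambda>h. x + h *\<^sub>R u) (\<lambda>_. x)"
      by (rule agrees_drop_linear)
    from compose_expansion_1[OF is_Ck_dir_deriv[OF f] this]
    show "agrees (Suc 0) (\<lambda>h. dir_deriv f u (x + h *\<^sub>R u)) (\<lambda>_. dir_deriv f u x)"
      by simp
  qed simp
qed

lemma compose_expansion_3:
  fixes f :: "real^'m \<Rightarrow> real^'m"
  assumes "is_Ck 3 f" "agrees 3 p (\<lambda>h. x + h *\<^sub>R u + h^2 *\<^sub>R v)"
  shows "agrees 3 (\<lambda>h. f (p h)) (\<lambda>h. f x + h *\<^sub>R dir_deriv f u x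
    + h^2 *\<^sub>R (dir_deriv f v x + (1/2) *\<^sub>R dir_deriv (dir_deriv f u) u x))"
proof -
  have f: "is_Ck (Suc 2) f" using assms(1) by (simp add: numeral_3_eq_3 numeral_2_eq_2)
  have 3: "3 = Suc 2" by simp
  \<comment> \<open>The direction of differentiation moves with \<open>h\<close>. Linearity splits
    it into fixed directions, for which the lower expansions are available.\<close>
  have dir: "dir_deriv f (u + h *\<^sub>R (2 *\<^sub>R v)) y = dir_deriv f u y + h *\<^sub>R (2 *\<^sub>R dir_deriv f v y)" for h y
    by (simp add: linear_add[OF linear_dir_deriv[OF f]] linear_cmul[OF linear_dir_deriv[OF f]])
  show ?thesis
    unfolding 3
  proof (rule agrees_compose_curve[OF f assms(2)[unfolded 3]])
    show "((\<lambda>h. x + h *\<^sub>R u + h^2 *\<^sub>R v) has_vector_derivative u + h *\<^sub>R (2 *\<^sub>R v)) (at h)" for h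
      using quartic_has_vector_derivative[of x u v 0 0] by simp
    show "((\<lambda>h. f x + h *\<^sub>R dir_deriv f u x
        + h^2 *\<^sub>R (dir_deriv f v x + (1/2) *\<^sub>R dir_deriv (dir_deriv f u) u x))
       has_vector_derivative (dir_deriv f u x + h *\<^sub>R dir_deriv (dir_deriv f u) u x)
         + h *\<^sub>R (2 *\<^sub>R dir_deriv f v x)) (at h)" for h
      using quartic_has_vector_derivative[of "f x" "dir_deriv f u x"
          "dir_deriv f v x + (1/2) *\<^sub>R dir_deriv (dir_deriv f u) u x" 0 0 h UNIV]
      by (simp add: algebra_simps)
    have q2: "agrees 2 (\<lambda>h. x + h *\<^sub>R u + h^2 *\<^sub>R v) (\<lambda>h. x + h *\<^sub>R u)"
      by (rule agrees_drop_term) simp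
    have q1: "agrees 1 (\<lambda>h. x + h *\<^sub>R u + h^2 *\<^sub>R v) (\<lambda>h. x)"
      using agrees_trans[OF agrees_mono[OF q2, of 1] agrees_drop_linear] by simp
    have 1: "agrees 2 (\<lambda>h. dir_deriv f u (x + h *\<^sub>R u + h^2 *\<^sub>R v))
        (\<lambda>h. dir_deriv f u x + h *\<^sub>R dir_deriv (dir_deriv f u) u x)"
      by (rule compose_expansion_2[OF is_Ck_dir_deriv[OF f] q2])
    have 2: "agrees 2 (\<lambda>h. h *\<^sub>R (2 *\<^sub>R dir_deriv f v (x + h *\<^sub>R u + h^2 *\<^sub>R v)))
        (\<lambda>h. h *\<^sub>R (2 *\<^sub>R dir_deriv f v x))"
      using agrees_times_scaleR[OF agrees_scaleR[OF compose_expansion_1[OF _ q1]]]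
        is_Ck_mono[OF is_Ck_dir_deriv[OF f], of 1 v]
      by (simp add: numeral_2_eq_2)
    show "agrees 2 (\<lambda>h. dir_deriv f (u + h *\<^sub>R (2 *\<^sub>R v)) (x + h *\<^sub>R u + h^2 *\<^sub>R v))
        (\<lambda>h. (dir_deriv f u x + h *\<^sub>R dir_deriv (dir_deriv f u) u x)
         + h *\<^sub>R (2 *\<^sub>R dir_deriv f v x))"
      unfolding dir by (rule agrees_add[OF 1 2])
  qed simp
qed

lemma compose_expansion_4:
  fixes f :: "real^'m \<Rightarrow> real^'m"
  assumes "is_Ck 4 f" "agrees 4 p (\<lambda>h. x + h *\<^sub>R u + h^2 *\<^sub>R v + h^3 *\<^sub>R w)"
  shows "agrees 4 (\<lambda>h. f (p h)) (\<lambda>h. f x + h *\<^sub>R dir_deriv f u x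
    + h^2 *\<^sub>R (dir_deriv f v x + (1/2) *\<^sub>R dir_deriv (dir_deriv f u) u x)
    + h^3 *\<^sub>R (dir_deriv f w x + dir_deriv (dir_deriv f u) v x
        + (1/6) *\<^sub>R dir_deriv (dir_deriv (dir_deriv f u) u) u x))"
proof -
  let ?D = "dir_deriv"
  have f: "is_Ck (Suc 3) f" using assms(1) by (simp add: eval_nat_numeral)
  have 4: "4 = Suc 3" by simp
  have dir: "?D f (u + h *\<^sub>R (2 *\<^sub>R v) + h^2 *\<^sub>R (3 *\<^sub>R w)) y
      = ?D f u y + h *\<^sub>R (2 *\<^sub>R ?D f v y) + h^2 *\<^sub>R (3 *\<^sub>R ?D f w y)" for h y
    by (simp add: linear_add[OF linear_dir_deriv[OF f]] linear_cmul[OF linear_dir_deriv[OF f]])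
  \<comment> \<open>The \<open>h\<^sup>2\<close> coefficient of the derivative contains one mixed
    derivative in one order and two in the other. Symmetry merges them into three equal terms,
    matching the factor 3 from differentiating \<open>h\<^sup>3\<close>.\<close>
  have comm: "?D (?D f v) u x = ?D (?D f u) v x"
    by (rule dir_deriv_commute[OF is_Ck_mono[OF assms(1)]]) simp
  let ?r' = "\<lambda>h. ?D f u x + h *\<^sub>R ?D (?D f u) u x
        + h^2 *\<^sub>R (?D (?D f u) v x + (1/2) *\<^sub>R ?D (?D (?D f u) u) u x)
      + h *\<^sub>R (2 *\<^sub>R (?D f v x + h *\<^sub>R ?D (?D f v) u x)) + h^2 *\<^sub>R (3 *\<^sub>R ?D f w x)"
  let ?q = "\<lambda>h. x + h *\<^sub>R u + h^2 *\<^sub>R v + h^3 *\<^sub>R w"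
  show ?thesis
    unfolding 4
  proof (rule agrees_compose_curve[OF f assms(2)[unfolded 4]])
    show "(?q has_vector_derivative u + h *\<^sub>R (2 *\<^sub>R v) + h^2 *\<^sub>R (3 *\<^sub>R w)) (at h)" for h
      using quartic_has_vector_derivative[of x u v w 0] by simp
    show "((\<lambda>h. f x + h *\<^sub>R ?D f u x + h^2 *\<^sub>R (?D f v x + (1/2) *\<^sub>R ?D (?D f u) u x)
        + h^3 *\<^sub>R (?D f w x + ?D (?D f u) v x + (1/6) *\<^sub>R ?D (?D (?D f u) u) u x))
      has_vector_derivative ?r' h) (at h)" for h
    proof -
      have "?r' h = ?D f u x + h *\<^sub>R (2 *\<^sub>R (?D f v x + (1/2) *\<^sub>R ?D (?D f u) u x))
        + h^2 *\<^sub>R (3 *\<^sub>R (?D f w x + ?D (?D f u) v x + (1/6) *\<^sub>R ?D (?D (?D f u) u) u x))"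
        by (simp add: comm vec_eq_iff algebra_simps power2_eq_square)
      show ?thesis
        unfolding \<open>?r' h = _\<close> using quartic_has_vector_derivative[of "f x" "?D f u x"
          "?D f v x + (1/2) *\<^sub>R ?D (?D f u) u x"
          "?D f w x + ?D (?D f u) v x + (1/6) *\<^sub>R ?D (?D (?D f u) u) u x" 0 h UNIV]
        by (simp only: scaleR_zero_right add_0_right)
    qed
    have q3: "agrees 3 ?q (\<lambda>h. x + h *\<^sub>R u + h^2 *\<^sub>R v)"
      by (rule agrees_drop_term) simp
    have q2: "agrees 2 ?q (\<lambda>h. x + h *\<^sub>R u)"
      by (rule agrees_trans[OF agrees_mono[OF q3] agrees_drop_term]) simp_all
    have q1: "agrees 1 ?q (\<lambda>h. x)"
      using agrees_trans[OF agrees_mono[OF q2, of 1] agrees_drop_linear] by simp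
    have 1: "agrees 3 (\<lambda>h. ?D f u (?q h)) (\<lambda>h. ?D f u x + h *\<^sub>R ?D (?D f u) u x
        + h^2 *\<^sub>R (?D (?D f u) v x + (1/2) *\<^sub>R ?D (?D (?D f u) u) u x))"
      by (rule compose_expansion_3[OF is_Ck_dir_deriv[OF f] q3])
    \<comment> \<open>Each power of \<open>h\<close> in front supplies one order, so order 2
      suffices for this derivative and order 1 for the next.\<close>
    have 2: "agrees 3 (\<lambda>h. h *\<^sub>R (2 *\<^sub>R ?D f v (?q h)))
        (\<lambda>h. h *\<^sub>R (2 *\<^sub>R (?D f v x + h *\<^sub>R ?D (?D f v) u x)))"
      using agrees_times_scaleR[OF agrees_scaleR[OF compose_expansion_2[OF _ q2]]]
        is_Ck_mono[OF is_Ck_dir_deriv[OF f], of 2 v]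
      by (simp add: eval_nat_numeral)
    have 3: "agrees 3 (\<lambda>h. h^2 *\<^sub>R (3 *\<^sub>R ?D f w (?q h))) (\<lambda>h. h^2 *\<^sub>R (3 *\<^sub>R ?D f w x))"
      using agrees_power_scaleR[OF agrees_scaleR[OF compose_expansion_1[OF _ q1]], of _ 2]
        is_Ck_mono[OF is_Ck_dir_deriv[OF f], of 1 w]
      by (simp add: eval_nat_numeral)
    show "agrees 3 (\<lambda>h. ?D f (u + h *\<^sub>R (2 *\<^sub>R v) + h^2 *\<^sub>R (3 *\<^sub>R w)) (?q h)) ?r'"
      unfolding dir by (rule agrees_add[OF agrees_add[OF 1 2] 3])
  qed simp
qed

subsection \<open>The matrix exponential\<close>

lemma matrix_power_scaleR: "matrix_power (s *\<^sub>R A) k = s ^ k *\<^sub>R matrix_power A k"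
  by (induction k) (simp_all add: matrix_scalar_ac scalar_matrix_assoc[symmetric] mult.commute)

text \<open>Matrix multiplication is bilinear on a finite-dimensional space, hence bounded with some
  constant \<open>c\<close>, which is absorbed into the base \<open>K\<close> of the geometric
  bound.\<close>

lemma matrix_power_bound:
  fixes A :: "real^'m^'m"
  obtains B K where "B \<ge> 0" "K \<ge> 0" "\<And>k. norm (matrix_power A k) \<le> B * K ^ k"
proof -
  have "bilinear (\<lambda>(X :: real^'m^'m) (Y :: real^'m^'m). X ** Y)"
    unfolding bilinear_def linear_iff
    by (auto simp: matrix_matrix_mult_def vec_eq_iff algebra_simps sum.distrib sum_distrib_left)
  then obtain c where c: "\<And>(X :: real^'m^'m) (Y :: real^'m^'m). norm (X ** Y) \<le> c * norm X * norm Y" "c > 0"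
    using bilinear_bounded_pos by metis
  show thesis
  proof
    show "norm (matrix_power A k) \<le> norm (mat 1 :: real^'m^'m) * (c * norm A) ^ k" for k
    proof (induction k)
      case (Suc k)
      have "norm (matrix_power A (Suc k)) \<le> c * norm A * norm (matrix_power A k)"
        unfolding matrix_power.simps by (rule c(1))
      also have "\<dots> \<le> c * norm A * (norm (mat 1 :: real^'m^'m) * (c * norm A) ^ k)"
        using Suc c(2) by (intro mult_left_mono) auto
      finally show ?case by (simp add: mult_ac)
    qed simp
  qed (use c(2) in auto)
qed

text \<open>For \<open>0 < h < 1\<close> the tail of the series from index \<open>n\<close> on is
  dominated by \<open>h ^ n\<close> times an exponential-type series independent of
  \<open>h\<close>, whose sum is the constant.\<close>

lemma matrix_exp_expansion:
  "agrees n (\<lambda>h. matrix_exp ((s * h) *\<^sub>R A)) (\<lambda>h. \<Sum>k<n. ((s * h) ^ k / fact k) *\<^sub>R matrix_power A k)"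
proof -
  obtain B K where BK: "B \<ge> 0" "K \<ge> 0" "\<And>k. norm (matrix_power A k) \<le> B * K ^ k"
    by (rule matrix_power_bound[of A]) blast
  define L where "L = \<bar>s\<bar> * K"
  have "L \<ge> 0" using BK by (simp add: L_def)
  let ?t = "\<lambda>h k. ((s * h) ^ k / fact k) *\<^sub>R matrix_power A k"
  have sum: "summable (\<lambda>k. B * (L ^ k / fact k))"
    using summable_exp[of L] by (intro summable_mult) (simp add: divide_inverse mult.commute)
  have t: "norm (?t h k) \<le> B * (L ^ k / fact k) * h ^ k" if "h \<ge> 0" for h k
  proof -
    have "norm (?t h k) = (\<bar>s\<bar> * h) ^ k / fact k * norm (matrix_power A k)"
      using that by (simp add: abs_mult power_abs)
    also have "\<dots> \<le> (\<bar>s\<bar> * h) ^ k / fact k * (B * K ^ k)"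
      using BK(3)[of k] that by (intro mult_left_mono) auto
    also have "\<dots> = B * (L ^ k / fact k) * h ^ k"
      by (simp add: L_def power_mult_distrib)
    finally show ?thesis .
  qed
  show ?thesis
  proof (rule agreesI[OF zero_less_one])
    fix h :: real assume h: "0 < h" "h < 1"
    have "summable (?t h)"
    proof (rule summable_comparison_test'[OF sum])
      fix k :: nat
      have "norm (?t h k) \<le> B * (L ^ k / fact k) * h ^ k"
        using t h by simp
      also have "\<dots> \<le> B * (L ^ k / fact k) * 1"
        using h BK \<open>L \<ge> 0\<close> by (intro mult_left_mono power_le_one) auto
      finally show "norm (?t h k) \<le> B * (L ^ k / fact k)" by simp
    qed
    from suminf_minus_initial_segment[OF this, of n]
    have "matrix_exp ((s * h) *\<^sub>R A) - (\<Sum>k<n. ?t h k) = (\<Sum>k. ?t h (k + n))"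
      by (simp add: matrix_exp_def matrix_power_scaleR)
    also have "norm \<dots> \<le> (\<Sum>k. B * (L ^ (k + n) / fact (k + n)) * h ^ n)"
    proof (rule norm_suminf_le)
      fix k
      have "norm (?t h (k + n)) \<le> B * (L ^ (k + n) / fact (k + n)) * h ^ (k + n)"
        using t h by simp
      also have "\<dots> \<le> B * (L ^ (k + n) / fact (k + n)) * h ^ n"
        using h BK \<open>L \<ge> 0\<close> by (intro mult_left_mono power_decreasing) auto
      finally show "norm (?t h (k + n)) \<le> B * (L ^ (k + n) / fact (k + n)) * h ^ n" .
    next
      show "summable (\<lambda>k. B * (L ^ (k + n) / fact (k + n)) * h ^ n)"
        using summable_ignore_initial_segment[OF sum, of n] by (rule summable_mult2)
    qed
    also have "\<dots> = (\<Sum>k. B * (L ^ (k + n) / fact (k + n))) * h ^ n"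
      using summable_ignore_initial_segment[OF sum, of n] by (rule suminf_mult2[symmetric])
    finally show "norm (matrix_exp ((s * h) *\<^sub>R A) - (\<Sum>k<n. ?t h k))
      \<le> (\<Sum>k. B * (L ^ (k + n) / fact (k + n))) * h ^ n" .
  qed
qed

lemma matrix_exp_vector_expansion:
  "agrees n (\<lambda>h. matrix_exp ((s * h) *\<^sub>R A) *v y)
     (\<lambda>h. \<Sum>k<n. ((s * h) ^ k / fact k) *\<^sub>R (matrix_power A k *v y))"
proof -
  have "linear (\<lambda>X :: real^'a^'a. X *v y)"
    by (simp add: linear_iff matrix_vector_mult_add_rdistrib scaleR_matrix_vector_assoc)
  then have L: "bounded_linear (\<lambda>X :: real^'a^'a. X *v y)"
    by (simp add: linear_conv_bounded_linear)
  show ?thesis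
    using agrees_bounded_linear[OF L matrix_exp_expansion[of n s A]]
    by (simp add: linear_sum[OF bounded_linear.linear[OF L]] scaleR_matrix_vector_assoc)
qed

subsection \<open>Expansions of the stages and of the exact solution\<close>

locale smooth_field =
  fixes M :: "real^'m^'m" and f :: "real^'m \<Rightarrow> real^'m" and x :: "real^'m"
  assumes smooth: "is_Ck 4 f"
begin

definition g where "g = - (M *v x) + f x"
definition J where "J v = dir_deriv f v x"
text \<open>In terms of derivatives at \<open>x\<close>, \<open>B v\<close> is \<open>f''(g, v)\<close> and \<open>T\<close> is \<open>f'''(g, g, g)\<close>.\<close>

definition B where "B v = dir_deriv (dir_deriv f g) v x"
definition T where "T = dir_deriv (dir_deriv (dir_deriv f g) g) g x"

text \<open>Eliminating \<open>f x\<close> leaves only \<open>M\<close>, \<open>J\<close>,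
  \<open>B\<close> and \<open>T\<close> acting on \<open>x\<close> and \<open>g\<close>, so that
  expansions can be compared term by term.\<close>

lemma f_x: "f x = M *v x + g"
  by (simp add: g_def)

lemma smooth_Suc: "is_Ck (Suc 3) f"
  using smooth by (simp add: eval_nat_numeral)

lemma smooth_dir_deriv: "is_Ck (Suc 2) (dir_deriv f v)"
  using is_Ck_dir_deriv[OF smooth_Suc] by (simp add: eval_nat_numeral)

lemma smooth_dir_deriv2: "is_Ck (Suc 1) (dir_deriv (dir_deriv f v) w)"
  using is_Ck_dir_deriv[OF smooth_dir_deriv] by (simp add: eval_nat_numeral)

lemma linear_J: "linear J"
  unfolding J_def[abs_def] by (rule linear_dir_deriv[OF smooth_Suc])

lemma linear_B: "linear B"
  unfolding B_def[abs_def] by (rule linear_dir_deriv[OF smooth_dir_deriv])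

lemma linear_M: "linear ((*v) M)"
  by simp

lemmas linear_expand =
  linear_add[OF linear_J] linear_diff[OF linear_J] linear_cmul[OF linear_J] linear_neg[OF linear_J]
  linear_add[OF linear_B] linear_diff[OF linear_B] linear_cmul[OF linear_B] linear_neg[OF linear_B]
  linear_add[OF linear_M] linear_diff[OF linear_M] linear_cmul[OF linear_M] linear_neg[OF linear_M]

lemma jacobian_eq: "jacobian f (at x) *v v = J v"
proof -
  have "f differentiable (at x)"
    using has_derivative_dir_deriv[OF smooth_Suc] by (rule differentiableI)
  then have "(f has_derivative (*v) (jacobian f (at x))) (at x)"
    by (simp add: jacobian_works)
  then show ?thesis
    unfolding J_def dir_deriv_def by (metis frechet_derivative_at)
qed

lemma second_derivative_eq: "second_derivative f x v g = B v"
  by (simp add: second_derivative_def B_def dir_deriv_def[abs_def])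

lemma dir_deriv_scaleR:
  assumes "is_Ck (Suc k) F"
  shows "dir_deriv (\<lambda>y. c *\<^sub>R F y) v y = c *\<^sub>R dir_deriv F v y"
  unfolding dir_deriv_def[of "\<lambda>y. c *\<^sub>R F y"]
  by (rule fun_cong[OF frechet_derivative_at[symmetric]])
    (intro has_derivative_scaleR_right has_derivative_dir_deriv[OF assms])

lemma dir_deriv_f_scaleR: "dir_deriv f (c *\<^sub>R v) = (\<lambda>y. c *\<^sub>R dir_deriv f v y)"
  by (rule ext) (rule linear_cmul[OF linear_dir_deriv[OF smooth_Suc]])

text \<open>The linear coefficient of a stage is \<open>c *\<^sub>R g\<close>. Homogeneity in the
  inner direction pulls \<open>c\<close> out, so that only derivatives along \<open>g\<close> itself
  remain.\<close>

lemma B_scaled: "dir_deriv (dir_deriv f (c *\<^sub>R g)) v x = c *\<^sub>R B v"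
  by (simp add: dir_deriv_f_scaleR dir_deriv_scaleR[OF smooth_dir_deriv] B_def)

lemma T_scaled:
  "dir_deriv (dir_deriv (dir_deriv f (c *\<^sub>R g)) (c *\<^sub>R g)) (c *\<^sub>R g) x = c ^ 3 *\<^sub>R T"
proof -
  have "dir_deriv (dir_deriv f (c *\<^sub>R g)) (c *\<^sub>R g) = (\<lambda>y. c\<^sup>2 *\<^sub>R dir_deriv (dir_deriv f g) g y)"
    by (simp add: dir_deriv_f_scaleR dir_deriv_scaleR[OF smooth_dir_deriv] fun_eq_iff
        linear_cmul[OF linear_dir_deriv[OF smooth_dir_deriv]] power2_eq_square)
  then show ?thesis
    by (simp add: dir_deriv_scaleR[OF smooth_dir_deriv2] T_def
        linear_cmul[OF linear_dir_deriv[OF smooth_dir_deriv2]] power2_eq_square power3_eq_cube)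
qed

text \<open>
  \<open>stage\<close> is the expansion of a stage with node \<open>c\<close>, where \<open>\<alpha>\<close>, \<open>\<beta>\<close>, \<open>\<gamma>\<close> stand for the sums of
  \<open>a\<^sub>i\<^sub>j c\<^sub>j\<close>, \<open>a\<^sub>i\<^sub>j c\<^sub>j\<^sup>2\<close> and \<open>a\<^sub>i\<^sub>j \<alpha>\<^sub>j\<close>; \<open>f_stage\<close> is the resulting expansion of \<open>f\<close> at that stage.
\<close>

definition stage :: "real \<Rightarrow> real \<Rightarrow> real \<Rightarrow> real \<Rightarrow> real \<Rightarrow> real^'m" where
  "stage c \<alpha> \<beta> \<gamma> h = x + h *\<^sub>R (c *\<^sub>R g) + h^2 *\<^sub>R ((c^2/2) *\<^sub>R (M *v (M *v x)) + \<alpha> *\<^sub>R J g)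
     + h^3 *\<^sub>R ((\<beta>/2) *\<^sub>R (J (M *v (M *v x)) + B g) + \<gamma> *\<^sub>R J (J g) - (c^3/6) *\<^sub>R (M *v (M *v (M *v x))))"

definition f_stage :: "real \<Rightarrow> real \<Rightarrow> real \<Rightarrow> real \<Rightarrow> real \<Rightarrow> real^'m" where
  "f_stage c \<alpha> \<beta> \<gamma> h = f x + h *\<^sub>R (c *\<^sub>R J g)
     + h^2 *\<^sub>R ((c^2/2) *\<^sub>R (J (M *v (M *v x)) + B g) + \<alpha> *\<^sub>R J (J g))
     + h^3 *\<^sub>R ((\<beta>/2) *\<^sub>R J (J (M *v (M *v x)) + B g) + \<gamma> *\<^sub>R J (J (J g))
         - (c^3/6) *\<^sub>R J (M *v (M *v (M *v x)))
         + (c^3/2) *\<^sub>R B (M *v (M *v x)) + (c * \<alpha>) *\<^sub>R B (J g) + (c^3/6) *\<^sub>R T)"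

text \<open>This is \<open>compose_expansion_4\<close> with \<open>u\<close>, \<open>v\<close>,
  \<open>w\<close> read off from \<open>stage\<close>, multiplied out by linearity of
  \<open>J\<close> and \<open>B\<close>.\<close>

lemma agrees_f_stage:
  assumes "agrees 4 p (stage c \<alpha> \<beta> \<gamma>)"
  shows "agrees 4 (\<lambda>h. f (p h)) (f_stage c \<alpha> \<beta> \<gamma>)"
proof -
  have "agrees 4 (\<lambda>h. f (p h)) (\<lambda>h. f x + h *\<^sub>R J (c *\<^sub>R g)
    + h^2 *\<^sub>R (J ((c^2/2) *\<^sub>R (M *v (M *v x)) + \<alpha> *\<^sub>R J g) + (1/2) *\<^sub>R c *\<^sub>R B (c *\<^sub>R g))
    + h^3 *\<^sub>R (J ((\<beta>/2) *\<^sub>R (J (M *v (M *v x)) + B g) + \<gamma> *\<^sub>R J (J g) - (c^3/6) *\<^sub>R (M *v (M *v (M *v x))))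
        + c *\<^sub>R B ((c^2/2) *\<^sub>R (M *v (M *v x)) + \<alpha> *\<^sub>R J g) + (1/6) *\<^sub>R c ^ 3 *\<^sub>R T))"
    using compose_expansion_4[OF smooth assms[unfolded stage_def[abs_def]]]
    unfolding B_scaled T_scaled J_def[symmetric] .
  then show ?thesis
    unfolding f_stage_def[abs_def]
    by (simp add: linear_expand algebra_simps power2_eq_square power3_eq_cube)
qed

lemma agrees_exp:
  "agrees 5 (\<lambda>h. matrix_exp ((- (s * h)) *\<^sub>R M) *v x)
     (\<lambda>h. x + h *\<^sub>R ((- s) *\<^sub>R (M *v x)) + h^2 *\<^sub>R ((s^2/2) *\<^sub>R (M *v (M *v x)))
        - h^3 *\<^sub>R ((s^3/6) *\<^sub>R (M *v (M *v (M *v x))))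
        + h^4 *\<^sub>R ((s^4/24) *\<^sub>R (M *v (M *v (M *v (M *v x))))))"
proof -
  have "(\<Sum>k<5. (((- s) * h) ^ k / fact k) *\<^sub>R (matrix_power M k *v x)) =
      x + h *\<^sub>R ((- s) *\<^sub>R (M *v x)) + h^2 *\<^sub>R ((s^2/2) *\<^sub>R (M *v (M *v x)))
        - h^3 *\<^sub>R ((s^3/6) *\<^sub>R (M *v (M *v (M *v x))))
        + h^4 *\<^sub>R ((s^4/24) *\<^sub>R (M *v (M *v (M *v (M *v x)))))" for h
    by (simp add: eval_nat_numeral matrix_vector_mul_assoc[symmetric] algebra_simps)
  then show ?thesis
    using matrix_exp_vector_expansion[of 5 "- s" M x] by simp
qed

text \<open>The inner stages and the final update have this common shape. The factor
  \<open>h\<close> lifts order 4 of the \<open>f\<close> values to order 5, and \<open>s\<close> is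
  left independent of the weights, so that the update can take \<open>s = 1\<close>.\<close>

lemma agrees_exponential_step:
  assumes "\<And>j. j \<in> I \<Longrightarrow> agrees 4 (p j) (f_stage (c j) (\<alpha> j) (\<beta> j) (\<gamma> j))"
  shows "agrees 5 (\<lambda>h. matrix_exp ((- (s * h)) *\<^sub>R M) *v x + h *\<^sub>R (\<Sum>j\<in>I. a j *\<^sub>R p j h))
    (\<lambda>h. x + h *\<^sub>R ((\<Sum>j\<in>I. a j) *\<^sub>R f x - s *\<^sub>R (M *v x))
       + h^2 *\<^sub>R ((s^2/2) *\<^sub>R (M *v (M *v x)) + (\<Sum>j\<in>I. a j * c j) *\<^sub>R J g)
       + h^3 *\<^sub>R (((\<Sum>j\<in>I. a j * c j ^ 2)/2) *\<^sub>R (J (M *v (M *v x)) + B g)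
           + (\<Sum>j\<in>I. a j * \<alpha> j) *\<^sub>R J (J g) - (s^3/6) *\<^sub>R (M *v (M *v (M *v x))))
       + h^4 *\<^sub>R ((s^4/24) *\<^sub>R (M *v (M *v (M *v (M *v x))))
           + ((\<Sum>j\<in>I. a j * \<beta> j)/2) *\<^sub>R J (J (M *v (M *v x)) + B g)
           + (\<Sum>j\<in>I. a j * \<gamma> j) *\<^sub>R J (J (J g))
           + (\<Sum>j\<in>I. a j * c j * \<alpha> j) *\<^sub>R B (J g)
           + ((\<Sum>j\<in>I. a j * c j ^ 3)/6) *\<^sub>R (3 *\<^sub>R B (M *v (M *v x)) + T - J (M *v (M *v (M *v x))))))"
    (is "agrees 5 _ ?r")
proof -
  let ?q = "\<lambda>h. (\<Sum>j\<in>I. a j) *\<^sub>R f x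
       + h *\<^sub>R ((\<Sum>j\<in>I. a j * c j) *\<^sub>R J g)
       + h^2 *\<^sub>R (((\<Sum>j\<in>I. a j * c j ^ 2)/2) *\<^sub>R (J (M *v (M *v x)) + B g)
           + (\<Sum>j\<in>I. a j * \<alpha> j) *\<^sub>R J (J g))
       + h^3 *\<^sub>R (((\<Sum>j\<in>I. a j * \<beta> j)/2) *\<^sub>R J (J (M *v (M *v x)) + B g)
           + (\<Sum>j\<in>I. a j * \<gamma> j) *\<^sub>R J (J (J g))
           + (\<Sum>j\<in>I. a j * c j * \<alpha> j) *\<^sub>R B (J g)
           + ((\<Sum>j\<in>I. a j * c j ^ 3)/6) *\<^sub>R (3 *\<^sub>R B (M *v (M *v x)) + T - J (M *v (M *v (M *v x)))))"
  \<comment> \<open>\<open>f_stage\<close> is linear in the monomials \<open>1\<close>,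
    \<open>c\<close>, \<open>c\<^sup>2\<close>, \<open>c\<^sup>3\<close>, \<open>\<alpha>\<close>,
    \<open>\<beta>\<close>, \<open>\<gamma>\<close> and \<open>c * \<alpha>\<close>, so a weighted
    sum depends only on the weighted sums of these.\<close>
  have "(\<Sum>j\<in>I. a j *\<^sub>R f_stage (c j) (\<alpha> j) (\<beta> j) (\<gamma> j) h) = ?q h" for h
    by (induction I rule: infinite_finite_induct)
      (simp_all add: f_stage_def algebra_simps add_divide_distrib)
  moreover have "agrees 4 (\<lambda>h. \<Sum>j\<in>I. a j *\<^sub>R p j h)
      (\<lambda>h. \<Sum>j\<in>I. a j *\<^sub>R f_stage (c j) (\<alpha> j) (\<beta> j) (\<gamma> j) h)"
    by (intro agrees_sum agrees_scaleR assms)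
  ultimately have "agrees 4 (\<lambda>h. \<Sum>j\<in>I. a j *\<^sub>R p j h) ?q"
    by simp
  then have "agrees (Suc 4) (\<lambda>h. h *\<^sub>R (\<Sum>j\<in>I. a j *\<^sub>R p j h)) (\<lambda>h. h *\<^sub>R ?q h)"
    by (rule agrees_times_scaleR)
  then have "agrees 5 (\<lambda>h. h *\<^sub>R (\<Sum>j\<in>I. a j *\<^sub>R p j h)) (\<lambda>h. h *\<^sub>R ?q h)"
    by simp
  note agrees_add[OF agrees_exp[of s] this]
  also have "agrees 5 (\<lambda>h. x + h *\<^sub>R ((- s) *\<^sub>R (M *v x)) + h^2 *\<^sub>R ((s^2/2) *\<^sub>R (M *v (M *v x)))
        - h^3 *\<^sub>R ((s^3/6) *\<^sub>R (M *v (M *v (M *v x))))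
        + h^4 *\<^sub>R ((s^4/24) *\<^sub>R (M *v (M *v (M *v (M *v x))))) + h *\<^sub>R ?q h) ?r"
    by (intro agrees_eq ext) (simp add: algebra_simps eval_nat_numeral)
  finally show ?thesis .
qed

text \<open>Because the node is the sum of the weights, the linear coefficient collapses to
  \<open>s *\<^sub>R g\<close>; the \<open>h^4\<close> term is dropped.\<close>

lemma agrees_stage:
  assumes "\<And>j. j \<in> I \<Longrightarrow> agrees 4 (p j) (f_stage (c j) (\<alpha> j) (\<beta> j) (\<gamma> j))"
    and "s = (\<Sum>j\<in>I. a j)"
  shows "agrees 4 (\<lambda>h. matrix_exp ((- (s * h)) *\<^sub>R M) *v x + h *\<^sub>R (\<Sum>j\<in>I. a j *\<^sub>R p j h))
    (stage s (\<Sum>j\<in>I. a j * c j) (\<Sum>j\<in>I. a j * c j ^ 2) (\<Sum>j\<in>I. a j * \<alpha> j))"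
proof -
  have sg: "s *\<^sub>R f x - s *\<^sub>R (M *v x) = s *\<^sub>R g"
    by (simp add: f_x algebra_simps)
  note agrees_mono[OF agrees_exponential_step[of I p c \<alpha> \<beta> \<gamma> s a, OF assms(1)], where m = 4]
  also note agrees_drop_term[OF order_refl]
  finally show ?thesis
    unfolding stage_def[abs_def] assms(2)[symmetric] sg by simp
qed

text \<open>
  The Taylor coefficients of the exact solution, with the factor \<open>1/k!\<close> included, obtained by
  comparing powers of \<open>h\<close> in the differential equation.
\<close>

definition u2 where "u2 = (1/2) *\<^sub>R (J g - M *v g)"
definition u3 where "u3 = (1/3) *\<^sub>R (J u2 + (1/2) *\<^sub>R B g - M *v u2)"
definition u4 where "u4 = (1/4) *\<^sub>R (J u3 + B u2 + (1/6) *\<^sub>R T - M *v u3)"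

text \<open>An expansion of \<open>z\<close> to order \<open>n\<close> yields one of the right-hand
  side to order \<open>n\<close>, and integration raises it to \<open>n + 1\<close>. Continuity at 0
  provides the start.\<close>

lemma solution_expansion:
  assumes "0 < S" "z 0 = x"
    and z: "\<And>h. h \<in> {0..S} \<Longrightarrow> (z has_vector_derivative (f (z h) - M *v z h)) (at h within {0..S})"
  shows "agrees 5 z (\<lambda>h. x + h *\<^sub>R g + h^2 *\<^sub>R u2 + h^3 *\<^sub>R u3 + h^4 *\<^sub>R u4)"
proof -
  let ?z' = "\<lambda>h. f (z h) - M *v z h"
  have step: "agrees (Suc n) z r"
    if "agrees n ?z' r'" "\<And>h. (r has_vector_derivative r' h) (at h)" "r 0 = x" for n r r'
    by (rule agrees_integrate[OF assms(1) z has_vector_derivative_at_within[OF that(2)] _ that(1)])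
      (auto simp: assms(2) that(3))
  have sub: "agrees n ?z' (\<lambda>h. q h - M *v r h)"
    if "agrees n (\<lambda>h. f (z h)) q" "agrees n z r" for n q r
    using agrees_add[OF that(1) agrees_scaleR[OF agrees_bounded_linear[OF matrix_vector_mul_bounded_linear that(2), of M], of "-1"]]
    by simp
  have "continuous (at 0 within {0..S}) z"
    using z[of 0] assms(1) by (auto intro: has_vector_derivative_continuous)
  then have lim: "(z \<longlongrightarrow> x) (at_right 0)"
    using assms(1,2) by (simp add: continuous_within at_within_Icc_at_right)
  have C1: "is_Ck 1 f" and C2: "is_Ck 2 f" and C3: "is_Ck 3 f"
    by (rule is_Ck_mono[OF smooth], simp)+
  have 0: "agrees 0 z (\<lambda>_. x)"
    by (rule agrees_0_of_tendsto[OF lim])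
  have "agrees 0 ?z' (\<lambda>_. f x - M *v x)"
    by (rule sub[OF agrees_C1_compose[OF C1 0 lim tendsto_const] 0])
  \<comment> \<open>At order 0 any constant may stand for any other; 0 is taken because its
    antiderivative is the constant curve at \<open>x\<close>.\<close>
  then have "agrees 0 ?z' (\<lambda>_. 0)"
    by (rule agrees_trans) (rule agreesI[of 1 _ _ "norm (f x - M *v x)"], auto)
  from step[OF this, of "\<lambda>_. x"] have 1: "agrees 1 z (\<lambda>_. x)" by simp
  have "agrees (Suc 1) z (\<lambda>h. x + h *\<^sub>R g)"
  proof (rule step[OF sub[OF compose_expansion_1[OF C1 1] 1]])
    show "((\<lambda>h. x + h *\<^sub>R g) has_vector_derivative f x - M *v x) (at h)" for h
      using quartic_has_vector_derivative[of x g 0 0 0 h UNIV] by (simp add: f_x)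
  qed simp
  then have 2: "agrees 2 z (\<lambda>h. x + h *\<^sub>R g)" by (simp add: numeral_2_eq_2)
  have "agrees (Suc 2) z (\<lambda>h. x + h *\<^sub>R g + h^2 *\<^sub>R u2)"
  proof (rule step[OF sub[OF compose_expansion_2[OF C2 2] 2]])
    show "((\<lambda>h. x + h *\<^sub>R g + h^2 *\<^sub>R u2) has_vector_derivative
       f x + h *\<^sub>R dir_deriv f g x - M *v (x + h *\<^sub>R g)) (at h)" for h
      using quartic_has_vector_derivative[of x g u2 0 0 h UNIV]
      by (simp add: J_def[symmetric] linear_expand f_x u2_def algebra_simps)
  qed simp
  then have 3: "agrees 3 z (\<lambda>h. x + h *\<^sub>R g + h^2 *\<^sub>R u2)" by simp
  have "agrees (Suc 3) z (\<lambda>h. x + h *\<^sub>R g + h^2 *\<^sub>R u2 + h^3 *\<^sub>R u3)"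
  proof (rule step[OF sub[OF compose_expansion_3[OF C3 3] 3]])
    \<comment> \<open>In this form the recursions rewrite the derivative of the polynomial directly
      into the right-hand side of the equation.\<close>
    have 3: "3 *\<^sub>R u3 = J u2 + (1/2) *\<^sub>R B g - M *v u2" by (simp add: u3_def)
    have 2: "2 *\<^sub>R u2 = J g - M *v g" by (simp add: u2_def)
    show "((\<lambda>h. x + h *\<^sub>R g + h^2 *\<^sub>R u2 + h^3 *\<^sub>R u3) has_vector_derivative
       f x + h *\<^sub>R dir_deriv f g x + h^2 *\<^sub>R (dir_deriv f u2 x + (1/2) *\<^sub>R dir_deriv (dir_deriv f g) g x)
        - M *v (x + h *\<^sub>R g + h^2 *\<^sub>R u2)) (at h)" for h
      using quartic_has_vector_derivative[of x g u2 u3 0 h UNIV]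
      unfolding 2 3 J_def[symmetric] B_def[symmetric]
      by (simp add: linear_expand f_x algebra_simps)
  qed simp
  then have 4: "agrees 4 z (\<lambda>h. x + h *\<^sub>R g + h^2 *\<^sub>R u2 + h^3 *\<^sub>R u3)" by simp
  have "agrees (Suc 4) z (\<lambda>h. x + h *\<^sub>R g + h^2 *\<^sub>R u2 + h^3 *\<^sub>R u3 + h^4 *\<^sub>R u4)"
  proof (rule step[OF sub[OF compose_expansion_4[OF smooth 4] 4]])
    have 4: "4 *\<^sub>R u4 = J u3 + B u2 + (1/6) *\<^sub>R T - M *v u3" by (simp add: u4_def)
    have 3: "3 *\<^sub>R u3 = J u2 + (1/2) *\<^sub>R B g - M *v u2" by (simp add: u3_def)
    have 2: "2 *\<^sub>R u2 = J g - M *v g" by (simp add: u2_def)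
    show "((\<lambda>h. x + h *\<^sub>R g + h^2 *\<^sub>R u2 + h^3 *\<^sub>R u3 + h^4 *\<^sub>R u4) has_vector_derivative
       f x + h *\<^sub>R dir_deriv f g x + h^2 *\<^sub>R (dir_deriv f u2 x + (1/2) *\<^sub>R dir_deriv (dir_deriv f g) g x)
        + h^3 *\<^sub>R (dir_deriv f u3 x + dir_deriv (dir_deriv f g) u2 x
          + (1/6) *\<^sub>R dir_deriv (dir_deriv (dir_deriv f g) g) g x)
        - M *v (x + h *\<^sub>R g + h^2 *\<^sub>R u2 + h^3 *\<^sub>R u3)) (at h)" for h
      using quartic_has_vector_derivative[of x g u2 u3 u4 h UNIV]
      unfolding 2 3 4 J_def[symmetric] B_def[symmetric] T_def[symmetric]
      by (simp add: linear_expand f_x algebra_simps)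
  qed simp
  then show ?thesis by simp
qed

section \<open>Expansion of the numerical solution\<close>

text \<open>Both occurrences of \<open>H\<close> have \<open>g\<close> as second argument, the
  direction differentiated first, so each is a value of \<open>B\<close> as it stands.\<close>

lemma w4_eq:
  "w4 M f x h = - (h^2 *\<^sub>R ((1/2) *\<^sub>R (M *v f x)))
     + h^3 *\<^sub>R ((1/6) *\<^sub>R (M *v (M *v f x) - J (M *v f x) - M *v J g))
     + h^4 *\<^sub>R ((1/24) *\<^sub>R (- (M *v (M *v (M *v f x))) + J (M *v (M *v f x)) + M *v (M *v J g) - M *v B g
         - M *v J (- (M *v g) + J g) - J (M *v J g) - J (J (M *v f x)) - 3 *\<^sub>R B (M *v f x)))"
proof -
  have neg: "(- M + A) *v v = - (M *v v) + A *v v" for A v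
    using matrix_vector_mult_diff_rdistrib[of A M v] by simp
  have num: "fact 2 = (2::real)" "fact 3 = (6::real)" "fact 4 = (24::real)"
    by (simp_all add: eval_nat_numeral)
  show ?thesis
    unfolding w4_def Let_def g_def[symmetric] neg num second_derivative_eq
    by (simp add: matrix_vector_mult_diff_rdistrib jacobian_eq linear_neg[OF linear_B])
qed

text \<open>The eight order conditions prescribe precisely the eight weighted sums in
  \<open>agrees_exponential_step\<close>. The result no longer depends on the coefficients, and
  adding \<open>w4\<close> turns it into the Taylor polynomial of the solution.\<close>

lemma sverk4_expansion:
  assumes c: "\<And>i. c i = node a i"
    and "b 1 + b 2 + b 3 + b 4 = 1"
    and "b 2 * c 2 + b 3 * c 3 + b 4 * c 4 = 1/2"
    and "b 2 * (c 2)^2 + b 3 * (c 3)^2 + b 4 * (c 4)^2 = 1/3"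
    and "b 3 * a 3 2 * c 2 + b 4 * a 4 2 * c 2 + b 4 * a 4 3 * c 3 = 1/6"
    and "b 2 * (c 2)^3 + b 3 * (c 3)^3 + b 4 * (c 4)^3 = 1/4"
    and "b 3 * c 3 * a 3 2 * c 2 + b 4 * c 4 * a 4 2 * c 2 + b 4 * c 4 * a 4 3 * c 3 = 1/8"
    and "b 3 * a 3 2 * (c 2)^2 + b 4 * a 4 2 * (c 2)^2 + b 4 * a 4 3 * (c 3)^2 = 1/12"
    and "b 4 * a 4 3 * a 3 2 * c 2 = 1/24"
  shows "agrees 5 (sverk4 a b M f x) (\<lambda>h. x + h *\<^sub>R g + h^2 *\<^sub>R u2 + h^3 *\<^sub>R u3 + h^4 *\<^sub>R u4)"
proof -
  define E where "E s h = matrix_exp ((- (s * h)) *\<^sub>R M) *v x" for s h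
  define Y2 where "Y2 h = E (c 2) h + h *\<^sub>R (a 2 1 *\<^sub>R f x)" for h
  define Y3 where "Y3 h = E (c 3) h + h *\<^sub>R (a 3 1 *\<^sub>R f x + a 3 2 *\<^sub>R f (Y2 h))" for h
  define Y4 where "Y4 h = E (c 4) h
    + h *\<^sub>R (a 4 1 *\<^sub>R f x + a 4 2 *\<^sub>R f (Y2 h) + a 4 3 *\<^sub>R f (Y3 h))" for h
  \<comment> \<open>The values of \<open>f\<close> at the stages are indexed as one family, so that
    the lemmas about sums over \<open>{1..<i}\<close> apply.\<close>
  define p where "p j h = (if j = 1 then f x else if j = 2 then f (Y2 h)
    else if j = 3 then f (Y3 h) else f (Y4 h))" for j :: nat and h
  define \<alpha> where "\<alpha> i = (\<Sum>j = 1..<i. a i j * c j)" for i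
  define \<beta> where "\<beta> i = (\<Sum>j = 1..<i. a i j * c j ^ 2)" for i
  define \<gamma> where "\<gamma> i = (\<Sum>j = 1..<i. a i j * \<alpha> j)" for i
  have ivl: "{1..<2} = {1::nat}" "{1..<3} = {1, 2::nat}" "{1..<4} = {1, 2, 3::nat}"
      "{1..<5} = {1, 2, 3, 4::nat}"
    by auto
  \<comment> \<open>The first stage is constant, that is, a stage with all four parameters zero.
    Hence \<open>\<gamma> 4\<close> reduces to \<open>a 4 3 * a 3 2 * c 2\<close>, and the last
    order condition has a single term.\<close>
  have c1: "c 1 = 0" by (simp add: c node_def)
  have zero: "\<alpha> 1 = 0" "\<beta> 1 = 0" "\<gamma> 1 = 0" "\<alpha> 2 = 0" "\<beta> 2 = 0" "\<gamma> 2 = 0" "\<gamma> 3 = 0"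
    using c1 by (simp_all add: \<alpha>_def \<beta>_def \<gamma>_def ivl del: One_nat_def)
  let ?stage = "\<lambda>i. stage (c i) (\<alpha> i) (\<beta> i) (\<gamma> i)"
  have st: "agrees 4 (\<lambda>h. E (c i) h + h *\<^sub>R (\<Sum>j = 1..<i. a i j *\<^sub>R p j h)) (?stage i)"
    if "\<And>j. j \<in> {1..<i} \<Longrightarrow> agrees 4 (p j) (f_stage (c j) (\<alpha> j) (\<beta> j) (\<gamma> j))" for i
    unfolding E_def \<alpha>_def[of i] \<beta>_def[of i] \<gamma>_def[of i]
    by (rule agrees_stage[OF that]) (auto simp: c node_def)
  have p1: "agrees 4 (p 1) (f_stage (c 1) (\<alpha> 1) (\<beta> 1) (\<gamma> 1))"
    unfolding c1 zero by (rule agrees_eq) (simp add: p_def f_stage_def fun_eq_iff)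
  have "agrees 4 Y2 (?stage 2)"
    using st[of 2, unfolded ivl] p1 by (simp add: Y2_def[abs_def] p_def del: One_nat_def)
  then have p2: "agrees 4 (p 2) (f_stage (c 2) (\<alpha> 2) (\<beta> 2) (\<gamma> 2))"
    using agrees_f_stage by (simp add: p_def[abs_def])
  have "agrees 4 Y3 (?stage 3)"
    using st[of 3, unfolded ivl] p1 p2 by (auto simp del: One_nat_def simp: Y3_def[abs_def] p_def)
  then have p3: "agrees 4 (p 3) (f_stage (c 3) (\<alpha> 3) (\<beta> 3) (\<gamma> 3))"
    using agrees_f_stage by (simp add: p_def[abs_def])
  have "agrees 4 Y4 (?stage 4)"
    using st[of 4, unfolded ivl] p1 p2 p3 by (auto simp del: One_nat_def simp: Y4_def[abs_def] p_def add.assoc)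
  then have p4: "agrees 4 (p 4) (f_stage (c 4) (\<alpha> 4) (\<beta> 4) (\<gamma> 4))"
    using agrees_f_stage by (simp add: p_def[abs_def])
  have p: "agrees 4 (p j) (f_stage (c j) (\<alpha> j) (\<beta> j) (\<gamma> j))" if "j \<in> {1..<5}" for j
    using that p1 p2 p3 p4 unfolding ivl by auto
  have sverk4: "sverk4 a b M f x h = (E 1 h + h *\<^sub>R (\<Sum>j = 1..<5. b j *\<^sub>R p j h)) + w4 M f x h" for h
    by (simp add: sverk4_def Let_def ivl p_def Y4_def Y3_def Y2_def E_def c add.assoc del: One_nat_def)
  have order: "(\<Sum>j = 1..<5. b j) = 1"
    "(\<Sum>j = 1..<5. b j * c j) = 1/2"
    "(\<Sum>j = 1..<5. b j * c j ^ 2) = 1/3"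
    "(\<Sum>j = 1..<5. b j * \<alpha> j) = 1/6"
    "(\<Sum>j = 1..<5. b j * \<beta> j) = 1/12"
    "(\<Sum>j = 1..<5. b j * \<gamma> j) = 1/24"
    "(\<Sum>j = 1..<5. b j * c j * \<alpha> j) = 1/8"
    "(\<Sum>j = 1..<5. b j * c j ^ 3) = 1/4"
    using assms(2-) c1 zero
    by (simp_all add: ivl \<alpha>_def[of 3] \<alpha>_def[of 4] \<beta>_def[of 3] \<beta>_def[of 4] \<gamma>_def[of 4] algebra_simps del: One_nat_def)
  have "agrees 5 (sverk4 a b M f x) (\<lambda>h. x + h *\<^sub>R (1 *\<^sub>R f x - 1 *\<^sub>R (M *v x))
       + h^2 *\<^sub>R ((1^2/2) *\<^sub>R (M *v (M *v x)) + (1/2) *\<^sub>R J g)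
       + h^3 *\<^sub>R (((1/3)/2) *\<^sub>R (J (M *v (M *v x)) + B g)
           + (1/6) *\<^sub>R J (J g) - (1^3/6) *\<^sub>R (M *v (M *v (M *v x))))
       + h^4 *\<^sub>R ((1^4/24) *\<^sub>R (M *v (M *v (M *v (M *v x))))
           + ((1/12)/2) *\<^sub>R J (J (M *v (M *v x)) + B g)
           + (1/24) *\<^sub>R J (J (J g))
           + (1/8) *\<^sub>R B (J g)
           + ((1/4)/6) *\<^sub>R (3 *\<^sub>R B (M *v (M *v x)) + T - J (M *v (M *v (M *v x)))))
       + w4 M f x h)"
    using agrees_add[OF agrees_exponential_step[of "{1..<5}" p c \<alpha> \<beta> \<gamma> 1 b, OF p] agrees_refl[of 5 "w4 M f x"]]
    unfolding order sverk4[abs_def] E_def by simp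
  \<comment> \<open>This is an exact identity: once \<open>f x\<close> is replaced by
    \<open>M *v x + g\<close>, the two polynomials in \<open>h\<close> have the same
    coefficients.\<close>
  also have "agrees 5 \<dots> (\<lambda>h. x + h *\<^sub>R g + h^2 *\<^sub>R u2 + h^3 *\<^sub>R u3 + h^4 *\<^sub>R u4)"
    unfolding w4_eq u4_def u3_def u2_def f_x
    by (intro agrees_eq ext) (simp add: linear_expand algebra_simps)
  finally show ?thesis .
qed

end

text \<open>After shifting time to start at 0, the exact and the numerical solution agree to order 5
  with the same quartic polynomial, hence with each other.\<close>

theorem theorem3p2:
  fixes M :: "real^'m^'m" and f :: "real^'m \<Rightarrow> real^'m" and y0 :: "real^'m"
    and t0 tend :: real
    and a :: "nat \<Rightarrow> nat \<Rightarrow> real" and b c :: "nat \<Rightarrow> real"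
  assumes "symmetric_positive_definite M \<or> skew_hermitian (map_matrix complex_of_real M)"
    and "is_Ck 4 f"
    and "t0 < tend"
    and "\<And>i. c i = node a i"
    and "b 1 + b 2 + b 3 + b 4 = 1"
    and "b 2 * c 2 + b 3 * c 3 + b 4 * c 4 = 1/2"
    and "b 2 * (c 2)^2 + b 3 * (c 3)^2 + b 4 * (c 4)^2 = 1/3"
    and "b 3 * a 3 2 * c 2 + b 4 * a 4 2 * c 2 + b 4 * a 4 3 * c 3 = 1/6"
    and "b 2 * (c 2)^3 + b 3 * (c 3)^3 + b 4 * (c 4)^3 = 1/4"
    and "b 3 * c 3 * a 3 2 * c 2 + b 4 * c 4 * a 4 2 * c 2 + b 4 * c 4 * a 4 3 * c 3 = 1/8"
    and "b 3 * a 3 2 * (c 2)^2 + b 4 * a 4 2 * (c 2)^2 + b 4 * a 4 3 * (c 3)^2 = 1/12"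
    and "b 4 * a 4 3 * a 3 2 * c 2 = 1/24"
  shows "has_order 4 (sverk4 a b M f y0) M f t0 tend y0"
  unfolding has_order_def
proof (intro allI impI)
  fix y assume y: "solves_ivp M f t0 tend y0 y"
  interpret smooth_field M f y0 by unfold_locales (rule assms(2))
  let ?z = "\<lambda>h. y (t0 + h)"
  have "(?z has_vector_derivative (f (?z h) - M *v ?z h)) (at h within {0..tend - t0})"
    if "h \<in> {0..tend - t0}" for h
  proof -
    have "t0 + h \<in> {t0..tend}" using that by auto
    with y obtain y' where "(y has_vector_derivative y') (at (t0 + h) within {t0..tend})"
      "y' + M *v y (t0 + h) = f (y (t0 + h))"
      unfolding solves_ivp_def by blast
    then have y': "(y has_vector_derivative (f (?z h) - M *v ?z h)) (at (t0 + h) within {t0..tend})"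
      by (metis add_diff_cancel_right')
    have shift: "((\<lambda>h. t0 + h) has_vector_derivative 1) (at h within {0..tend - t0})"
      by (auto intro!: derivative_eq_intros)
    \<comment> \<open>The chain rule needs the derivative of \<open>y\<close> within the image of
      the step interval, which is the full time interval.\<close>
    have "(\<lambda>h. t0 + h) ` {0..tend - t0} = {t0..tend}" by simp
    then show ?thesis
      using vector_diff_chain_within[OF shift, of y] y' by (simp add: o_def)
  qed
  then have "agrees 5 ?z (\<lambda>h. y0 + h *\<^sub>R g + h^2 *\<^sub>R u2 + h^3 *\<^sub>R u3 + h^4 *\<^sub>R u4)"
    using y assms(3) by (intro solution_expansion) (auto simp: solves_ivp_def)
  with sverk4_expansion[of c a b, OF assms(4-)] have "agrees 5 (sverk4 a b M f y0) ?z"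
    by (blast intro: agrees_trans agrees_sym)
  then obtain C where *: "eventually (\<lambda>h. norm (sverk4 a b M f y0 h - ?z h) \<le> C * h ^ 5) (at_right 0)"
    unfolding agrees_def by blast
  show "(\<lambda>h. norm (sverk4 a b M f y0 h - y (t0 + h))) \<in> O[at_right 0](\<lambda>h. h ^ (4 + 1))"
  proof (rule bigoI[of _ C])
    show "eventually (\<lambda>h. norm (norm (sverk4 a b M f y0 h - y (t0 + h))) \<le> C * norm (h ^ (4 + 1)))
      (at_right 0)"
      \<comment> \<open>Positivity of \<open>h\<close> removes the norm around its power.\<close>
      using * eventually_at_right_less[of "0::real"] by eventually_elim simp
  qed
qed

end
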